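(* Let $H$ be a closed hyperplane of the (real) Kalton–Peck space $Z_2$ and let $j:\ell_2\to H$ be any isomorphism into (linear embedding that is an isomorphism onto its range). Then no symplectic form on $\ell_2$ can be extended through $j$ to a continuous bilinear form on $H$; that is, if $\omega$ is a symplectic form on $\ell_2$, there is no continuous bilinear form $\Omega:H\times H\to\mathbb R$ such that $\Omega(jx,jy)=\omega(x,y)$ for all $x,y\in\ell_2$.
   Context: A symplectic form on a real Banach space $X$ is a continuous alternating ($\omega(x,y)=-\omega(y,x)$) bilinear map $\omega:X\times X\to\mathbb R$ such that $L_\omega:X\to X^*$, $L_\omega(x)(y)=\omega(x,y)$, is an isomorphism onto. The Kalton–Peck space is $Z_2=\{(w,x)\in\ell_\infty\times\ell_2: w-\mathsf{KP}x\in\ell_2\}$ (real sequences) with the quasinorm, equivalent to a norm, $\|(w,x)\|=\|w-\mathsf{KP}x\|_2+\|x\|_2$, where $\mathsf{KP}x=x\log(|x|/\|x\|_2)$ coordinatewise (with $0\log 0=0$ and $\mathsf{KP}0=0$). *)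

theory Defs
  imports "HOL-Analysis.Analysis"
begin

section \<open>The sequence space \<open>\<ell>\<^sub>2\<close>\<close>

definition l2 :: "(nat \<Rightarrow> real) set" where
  "l2 = {x. summable (\<lambda>n. (x n)\<^sup>2)}"

definition l2norm :: "(nat \<Rightarrow> real) \<Rightarrow> real" where
  "l2norm x = sqrt (\<Sum>n. (x n)\<^sup>2)"

lemma l2_bound: 
  assumes "\<And>N. L2_set x {..<N} \<le> B"
  shows "x \<in> l2" and "l2norm x \<le> B"
proof -
  have B: "0 \<le> B" using assms[of 0] by simp
  have s: "(\<Sum>n<N. (x n)\<^sup>2) \<le> B\<^sup>2" for N
    using assms[of N] B unfolding L2_set_def by (simp add: real_sqrt_le_iff' sqrt_le_D)
  have "summable (\<lambda>n. (x n)\<^sup>2)"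
    by (rule summableI_nonneg_bounded[OF _ s]) simp
  then show "x \<in> l2" by (simp add: l2_def)
  have "(\<Sum>n. (x n)\<^sup>2) \<le> B\<^sup>2"
    using \<open>summable _\<close> s by (intro suminf_le_const) auto
  then show "l2norm x \<le> B"
    using B unfolding l2norm_def by (simp add: real_le_lsqrt)
qed

lemma L2_set_le_l2norm: 
  assumes "x \<in> l2" shows "L2_set x {..<N} \<le> l2norm x"
  unfolding L2_set_def l2norm_def using assms
  by (auto simp: l2_def intro!: sum_le_suminf)

lemma l2norm_nonneg: "x \<in> l2 \<Longrightarrow> 0 \<le> l2norm x"
  by (auto simp: l2_def l2norm_def intro!: suminf_nonneg)

lemma l2_nth_le: 
  assumes "x \<in> l2" shows "\<bar>x n\<bar> \<le> l2norm x"
proof -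
  have "\<bar>x n\<bar> = L2_set x {n}" by simp
  also have "\<dots> \<le> L2_set x {..<Suc n}"
    unfolding L2_set_def by (intro real_sqrt_le_mono sum_mono2) auto
  finally show ?thesis using L2_set_le_l2norm[OF assms] order_trans by blast
qed

lemma l2_zero [simp]: "(\<lambda>n. 0) \<in> l2" "l2norm (\<lambda>n. 0) = 0"
  by (auto simp: l2_def l2norm_def)

lemma l2_add: 
  assumes "x \<in> l2" "y \<in> l2"
  shows "(\<lambda>n. x n + y n) \<in> l2" and "l2norm (\<lambda>n. x n + y n) \<le> l2norm x + l2norm y"
proof -
  have *: "L2_set (\<lambda>n. x n + y n) {..<N} \<le> l2norm x + l2norm y" for N
    using L2_set_triangle_ineq[of x y "{..<N}"] L2_set_le_l2norm[OF assms(1), of N]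
      L2_set_le_l2norm[OF assms(2), of N] by linarith
  show "(\<lambda>n. x n + y n) \<in> l2" "l2norm (\<lambda>n. x n + y n) \<le> l2norm x + l2norm y"
    using l2_bound[OF *] by auto
qed

lemma l2_scale: 
  assumes "x \<in> l2"
  shows "(\<lambda>n. c * x n) \<in> l2" and "l2norm (\<lambda>n. c * x n) = \<bar>c\<bar> * l2norm x"
  using assms
  by (auto simp: l2_def l2norm_def power_mult_distrib suminf_mult real_sqrt_mult intro!: summable_mult)

lemma l2_minus: "x \<in> l2 \<Longrightarrow> (\<lambda>n. - x n) \<in> l2"
  using l2_scale(1)[of x "-1"] by simp

lemma l2_diff: "x \<in> l2 \<Longrightarrow> y \<in> l2 \<Longrightarrow> (\<lambda>n. x n - y n) \<in> l2"
  using l2_add(1)[OF _ l2_minus] by simp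

lemma l2_dominated: 
  assumes "y \<in> l2" "\<And>n. \<bar>x n\<bar> \<le> \<bar>y n\<bar>" shows "x \<in> l2"
proof -
  have "summable (\<lambda>n. (y n)\<^sup>2)" using assms by (simp add: l2_def)
  then show ?thesis unfolding l2_def
    by (auto intro!: summable_comparison_test'[of "\<lambda>n. (y n)\<^sup>2" 0] simp: abs_le_square_iff[symmetric] assms)
qed

lemma l2norm_eq_0: "x \<in> l2 \<Longrightarrow> l2norm x = 0 \<longleftrightarrow> x = (\<lambda>n. 0)"
  using l2_nth_le[of x] l2_zero(2) by fastforce

typedef ell2 = l2 morphisms ell2_nth Abs_ell2
  by (rule exI[of _ "\<lambda>n. 0"]) simp

setup_lifting type_definition_ell2

instantiation ell2 :: real_vector
begin
lift_definition zero_ell2 :: ell2 is "\<lambda>n. 0" by simp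
lift_definition plus_ell2 :: "ell2 \<Rightarrow> ell2 \<Rightarrow> ell2" is "\<lambda>x y n. x n + y n" by (rule l2_add)
lift_definition minus_ell2 :: "ell2 \<Rightarrow> ell2 \<Rightarrow> ell2" is "\<lambda>x y n. x n - y n" by (rule l2_diff)
lift_definition uminus_ell2 :: "ell2 \<Rightarrow> ell2" is "\<lambda>x n. - x n" by (rule l2_minus)
lift_definition scaleR_ell2 :: "real \<Rightarrow> ell2 \<Rightarrow> ell2" is "\<lambda>c x n. c * x n" by (rule l2_scale)
instance by standard (transfer; simp add: fun_eq_iff algebra_simps)+
end

instantiation ell2 :: real_normed_vector
begin
lift_definition norm_ell2 :: "ell2 \<Rightarrow> real" is l2norm .
definition "dist x y = norm (x - y)" for x y :: ell2
definition "sgn x = inverse (norm x) *\<^sub>R x" for x :: ell2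
definition "(uniformity :: (ell2 \<times> ell2) filter) = (INF e\<in>{0 <..}. principal {(x, y). dist x y < e})"
definition "open U \<longleftrightarrow> (\<forall>x\<in>U. eventually (\<lambda>(x', y). x' = x \<longrightarrow> y \<in> U) uniformity)" for U :: "ell2 set"
instance
proof
  fix x y :: ell2 and c :: real
  show "norm x = 0 \<longleftrightarrow> x = 0" by transfer (rule l2norm_eq_0)
  show "norm (x + y) \<le> norm x + norm y" by transfer (rule l2_add)
  show "norm (c *\<^sub>R x) = \<bar>c\<bar> * norm x" by transfer (rule l2_scale)
qed (simp_all add: dist_ell2_def sgn_ell2_def uniformity_ell2_def open_ell2_def)
end

instance ell2 :: banach
proof
  fix X :: "nat \<Rightarrow> ell2"
  assume X: "Cauchy X"
  have le: "\<bar>ell2_nth x n\<bar> \<le> norm x" for x n by transfer (rule l2_nth_le)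
  have d: "ell2_nth (x - y) n = ell2_nth x n - ell2_nth y n" for x y n by transfer simp
  have "Cauchy (\<lambda>k. ell2_nth (X k) n)" for n
  proof (rule metric_CauchyI)
    fix e :: real assume "0 < e"
    then obtain M where M: "\<And>k m. k \<ge> M \<Longrightarrow> m \<ge> M \<Longrightarrow> dist (X k) (X m) < e"
      using metric_CauchyD[OF X] by blast
    have "dist (ell2_nth (X k) n) (ell2_nth (X m) n) < e" if "k \<ge> M" "m \<ge> M" for k m
      using M[OF that] le[of "X k - X m" n] by (simp add: d dist_norm)
    then show "\<exists>M. \<forall>m\<ge>M. \<forall>n'\<ge>M. dist (ell2_nth (X m) n) (ell2_nth (X n') n) < e" by blast
  qed
  then have "\<forall>n. \<exists>l. (\<lambda>k. ell2_nth (X k) n) \<longlonglongrightarrow> l"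
    by (simp add: real_Cauchy_convergent convergent_def[symmetric])
  then obtain l where l: "\<And>n. (\<lambda>k. ell2_nth (X k) n) \<longlonglongrightarrow> l n" by metis
  have key: "(\<lambda>n. ell2_nth (X k) n - l n) \<in> l2 \<and> l2norm (\<lambda>n. ell2_nth (X k) n - l n) \<le> e"
    if M: "\<And>m. m \<ge> M \<Longrightarrow> dist (X k) (X m) < e" for k M e
  proof -
    have "L2_set (\<lambda>n. ell2_nth (X k) n - l n) {..<N} \<le> e" for N
    proof (rule LIMSEQ_le_const2)
      show "(\<lambda>m. L2_set (\<lambda>n. ell2_nth (X k) n - ell2_nth (X m) n) {..<N})
              \<longlonglongrightarrow> L2_set (\<lambda>n. ell2_nth (X k) n - l n) {..<N}"
        unfolding L2_set_def by (intro tendsto_intros l)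
      have "L2_set (\<lambda>n. ell2_nth (X k) n - ell2_nth (X m) n) {..<N} \<le> norm (X k - X m)" for m
        unfolding norm_ell2.rep_eq minus_ell2.rep_eq by (intro L2_set_le_l2norm l2_diff ell2_nth)
      then show "\<exists>M. \<forall>m\<ge>M. L2_set (\<lambda>n. ell2_nth (X k) n - ell2_nth (X m) n) {..<N} \<le> e"
        using M by (metis dist_norm less_imp_le order_trans)
    qed
    then show ?thesis using l2_bound by blast
  qed
  obtain M where M: "\<And>k m. k \<ge> M \<Longrightarrow> m \<ge> M \<Longrightarrow> dist (X k) (X m) < 1"
    using metric_CauchyD[OF X, of 1] by auto
  have "(\<lambda>n. ell2_nth (X M) n - l n) \<in> l2" using key[of M M 1] M by blast
  from l2_diff[OF ell2_nth this, of "X M"] have L: "l \<in> l2" by simp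
  have nd: "norm (X k - Abs_ell2 l) = l2norm (\<lambda>n. ell2_nth (X k) n - l n)" for k
    by (simp add: norm_ell2.rep_eq minus_ell2.rep_eq Abs_ell2_inverse[OF L])
  have "X \<longlonglongrightarrow> Abs_ell2 l"
  proof (rule metric_LIMSEQ_I)
    fix e :: real assume "0 < e"
    then obtain M where M: "\<And>k m. k \<ge> M \<Longrightarrow> m \<ge> M \<Longrightarrow> dist (X k) (X m) < e/2"
      using metric_CauchyD[OF X, of "e/2"] by auto
    have "dist (X k) (Abs_ell2 l) < e" if "k \<ge> M" for k
      using key[of M k "e/2"] M[OF that] \<open>0 < e\<close> by (simp add: dist_norm nd)
    then show "\<exists>M. \<forall>k\<ge>M. dist (X k) (Abs_ell2 l) < e" by blast
  qed
  then show "convergent X" by (auto simp: convergent_def)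
qed

section \<open>The Kalton--Peck space\<close>

text \<open>Since \<open>0 * t = 0\<close>, the value of \<open>ln\<close> at \<open>0\<close> and that of the quotient at
  \<open>l2norm x = 0\<close> play no role: both conventions \<open>0 log 0 = 0\<close> and \<open>KP 0 = 0\<close> hold.\<close>

definition KP :: "(nat \<Rightarrow> real) \<Rightarrow> nat \<Rightarrow> real" where
  "KP x n = x n * ln (\<bar>x n\<bar> / l2norm x)"

definition z2_carrier :: "((nat \<Rightarrow> real) \<times> (nat \<Rightarrow> real)) set" where
  "z2_carrier = {(w, x). Bseq w \<and> x \<in> l2 \<and> (\<lambda>n. w n - KP x n) \<in> l2}"

lemma phi_pos: 
  fixes s t :: real assumes "0 < s" "0 < t"
  shows "\<bar>(s + t) * ln (s + t) - s * ln s - t * ln t\<bar> \<le> s + t"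
proof -
  have e: "(s + t) * ln (s + t) - s * ln s - t * ln t = s * (ln (s + t) - ln s) + t * (ln (s + t) - ln t)"
    by (simp add: algebra_simps)
  have "0 \<le> s * (ln (s + t) - ln s)" "0 \<le> t * (ln (s + t) - ln t)" using assms by auto
  moreover have "ln (s + t) - ln s \<le> t / s"
    using ln_add_one_self_le_self[of "t / s"] ln_div[of "s + t" s] assms
    by (simp add: add_divide_distrib)
  then have "s * (ln (s + t) - ln s) \<le> t" using assms by (simp add: field_simps)
  moreover have "ln (s + t) - ln t \<le> s / t"
    using ln_add_one_self_le_self[of "s / t"] ln_div[of "s + t" t] assms
    by (simp add: add_divide_distrib add.commute)
  then have "t * (ln (s + t) - ln t) \<le> s" using assms by (simp add: field_simps)
  ultimately show ?thesis unfolding e by linarith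
qed

lemma phi_quasi_additive: 
  fixes s t :: real
  shows "\<bar>(s + t) * ln \<bar>s + t\<bar> - s * ln \<bar>s\<bar> - t * ln \<bar>t\<bar>\<bar> \<le> \<bar>s\<bar> + \<bar>t\<bar>"
proof -
  have opp: "\<bar>(s + t) * ln \<bar>s + t\<bar> - s * ln \<bar>s\<bar> - t * ln \<bar>t\<bar>\<bar> \<le> \<bar>s\<bar> + \<bar>t\<bar>"
    if "s > 0" "t < 0" "s + t > 0" for s t :: real
  proof -
    have "\<bar>s * ln s - (s + t) * ln (s + t) + t * ln (- t)\<bar> \<le> s"
      using phi_pos[of "s + t" "-t"] that by simp
    then have "\<bar>(s + t) * ln (s + t) - s * ln s - t * ln (- t)\<bar> \<le> s" by linarith
    then show ?thesis using that by simp
  qed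
  have opp0: "\<bar>(s + t) * ln \<bar>s + t\<bar> - s * ln \<bar>s\<bar> - t * ln \<bar>t\<bar>\<bar> \<le> \<bar>s\<bar> + \<bar>t\<bar>"
    if "s > 0" "t < 0" for s t :: real
  proof -
    consider "s + t > 0" | "s + t = 0" | "s + t < 0" by linarith
    then show ?thesis
    proof cases
      case 2
      then have "t = - s" by simp
      then show ?thesis using that by simp
    next
      case 3
      then have "\<bar>(-t + -s) * ln \<bar>-t + -s\<bar> - (-t) * ln \<bar>-t\<bar> - (-s) * ln \<bar>-s\<bar>\<bar> \<le> \<bar>-t\<bar> + \<bar>-s\<bar>"
        using that by (intro opp) auto
      moreover have "\<bar>-t + -s\<bar> = \<bar>s + t\<bar>" by (simp add: abs_if)
      ultimately show ?thesis
        by (simp add: algebra_simps abs_minus_commute)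
    qed (use opp that in auto)
  qed
  consider "s = 0" | "t = 0" | "s > 0" "t > 0" | "s < 0" "t < 0" | "s > 0" "t < 0" | "s < 0" "t > 0"
    by linarith
  then show ?thesis
  proof cases
    case 3 then show ?thesis using phi_pos[of s t] by simp
  next
    case 4
    then have "\<bar>(-s + -t) * ln (-s + -t) - (-s) * ln (-s) - (-t) * ln (-t)\<bar> \<le> -s + -t"
      by (intro phi_pos) auto
    moreover have "(-s + -t) * ln (-s + -t) - (-s) * ln (-s) - (-t) * ln (-t)
                  = - ((s + t) * ln (-s + -t) - s * ln (-s) - t * ln (-t))"
      by (simp add: algebra_simps)
    moreover have "\<bar>s + t\<bar> = -s + -t" "\<bar>s\<bar> = -s" "\<bar>t\<bar> = -t" using 4 by auto
    ultimately show ?thesis by (metis abs_minus_cancel)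
  next
    case 5 then show ?thesis by (rule opp0)
  next
    case 6 then show ?thesis using opp0[of t s] by (simp add: algebra_simps)
  qed auto
qed

lemma KP_quasi_additive: 
  assumes x: "x \<in> l2" and y: "y \<in> l2"
  shows "(\<lambda>n. KP (\<lambda>n. x n + y n) n - KP x n - KP y n) \<in> l2"
proof -
  let ?z = "\<lambda>n. x n + y n"
  let ?phi = "\<lambda>s::real. s * ln \<bar>s\<bar>"
  have KP: "KP u n = ?phi (u n) - u n * ln (l2norm u)" if "u \<in> l2" for u n
  proof (cases "u n = 0")
    case False
    then have "l2norm u > 0" using l2_nth_le[OF that, of n] by linarith
    then show ?thesis using False by (simp add: KP_def ln_div algebra_simps)
  qed (simp add: KP_def)
  have a: "(\<lambda>n. \<bar>x n\<bar> + \<bar>y n\<bar>) \<in> l2"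
    by (intro l2_add l2_dominated[OF x] l2_dominated[OF y]) auto
  have b: "(\<lambda>n. ?phi (x n + y n) - ?phi (x n) - ?phi (y n)) \<in> l2"
  proof (rule l2_dominated[OF a])
    show "\<bar>?phi (x n + y n) - ?phi (x n) - ?phi (y n)\<bar> \<le> \<bar>\<bar>x n\<bar> + \<bar>y n\<bar>\<bar>" for n
      using phi_quasi_additive[of "x n" "y n"] by simp
  qed
  have "(\<lambda>n. ((?phi (x n + y n) - ?phi (x n) - ?phi (y n))
             - ln (l2norm ?z) * ?z n) + (ln (l2norm x) * x n + ln (l2norm y) * y n)) \<in> l2"
    by (intro l2_add(1) l2_diff l2_scale(1) b x y)
  then show ?thesis
    by (rule back_subst[of "\<lambda>f. f \<in> l2"])
      (simp add: fun_eq_iff KP[OF x] KP[OF y] KP[OF l2_add(1)[OF x y]] algebra_simps)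
qed

lemma KP_scale: "x \<in> l2 \<Longrightarrow> KP (\<lambda>n. c * x n) n = c * KP x n"
  by (cases "c = 0") (simp_all add: KP_def l2_scale abs_mult)

lemma z2_add: 
  assumes "(w, x) \<in> z2_carrier" "(v, y) \<in> z2_carrier"
  shows "(\<lambda>n. w n + v n, \<lambda>n. x n + y n) \<in> z2_carrier"
proof -
  from assms have x: "x \<in> l2" and y: "y \<in> l2" by (auto simp: z2_carrier_def)
  have "(\<lambda>n. ((w n - KP x n) + (v n - KP y n)) - (KP (\<lambda>n. x n + y n) n - KP x n - KP y n)) \<in> l2"
    using assms by (intro l2_diff[of "\<lambda>n. (w n - KP x n) + (v n - KP y n)"] l2_add(1) KP_quasi_additive)
      (auto simp: z2_carrier_def)
  then have "(\<lambda>n. w n + v n - KP (\<lambda>n. x n + y n) n) \<in> l2"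
    by (simp add: algebra_simps)
  moreover have "Bseq (\<lambda>n. w n + v n)"
  proof -
    obtain B C where "\<And>n. norm (w n) \<le> B" "\<And>n. norm (v n) \<le> C"
      using assms by (auto simp: z2_carrier_def Bseq_def)
    then show ?thesis by (intro BseqI'[of _ "B + C"] norm_triangle_mono)
  qed
  ultimately show ?thesis using l2_add(1)[OF x y] by (simp add: z2_carrier_def)
qed

lemma z2_scale: 
  assumes "(w, x) \<in> z2_carrier"
  shows "(\<lambda>n. c * w n, \<lambda>n. c * x n) \<in> z2_carrier"
proof -
  from assms have "Bseq (\<lambda>n. c * w n)"
    by (auto simp: z2_carrier_def intro!: Bseq_mult Bfun_const)
  then show ?thesis using assms l2_scale(1)[of "\<lambda>n. w n - KP x n" c]
    by (auto simp: z2_carrier_def KP_scale algebra_simps intro!: l2_scale)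
qed

lemma z2_minus: "(w, x) \<in> z2_carrier \<Longrightarrow> (\<lambda>n. - w n, \<lambda>n. - x n) \<in> z2_carrier"
  using z2_scale[of w x "-1"] by simp

lemma z2_zero: "(\<lambda>n. 0, \<lambda>n. 0) \<in> z2_carrier"
  by (auto simp: z2_carrier_def KP_def)

typedef z2 = z2_carrier
  using z2_zero by blast

setup_lifting type_definition_z2

instantiation z2 :: real_vector
begin
lift_definition zero_z2 :: z2 is "(\<lambda>n. 0, \<lambda>n. 0)" by (rule z2_zero)
lift_definition plus_z2 :: "z2 \<Rightarrow> z2 \<Rightarrow> z2"
  is "\<lambda>(w, x) (v, y). (\<lambda>n. w n + v n, \<lambda>n. x n + y n)" by (auto intro: z2_add)
lift_definition minus_z2 :: "z2 \<Rightarrow> z2 \<Rightarrow> z2"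
  is "\<lambda>(w, x) (v, y). (\<lambda>n. w n - v n, \<lambda>n. x n - y n)"
  using z2_add[OF _ z2_minus] by auto
lift_definition uminus_z2 :: "z2 \<Rightarrow> z2"
  is "\<lambda>(w, x). (\<lambda>n. - w n, \<lambda>n. - x n)" by (auto intro: z2_minus)
lift_definition scaleR_z2 :: "real \<Rightarrow> z2 \<Rightarrow> z2"
  is "\<lambda>c (w, x). (\<lambda>n. c * w n, \<lambda>n. c * x n)" by (auto intro: z2_scale)
instance by standard (transfer; auto simp: fun_eq_iff algebra_simps)+
end

lift_definition z2_qnorm :: "z2 \<Rightarrow> real"
  is "\<lambda>(w, x). l2norm (\<lambda>n. w n - KP x n) + l2norm x" .

text \<open>\<open>z2_qnorm\<close> is only a quasinorm, so \<open>z2\<close> is not made an instance of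
  \<open>real_normed_vector\<close>; it carries the vector topology that the quasinorm (hence any
  equivalent norm) defines. Quasinorm balls need not be open themselves.\<close>

instantiation z2 :: topological_space
begin
definition open_z2 :: "z2 set \<Rightarrow> bool" where
  "open_z2 U \<longleftrightarrow> (\<forall>u\<in>U. \<exists>e>0. \<forall>v. z2_qnorm (v - u) < e \<longrightarrow> v \<in> U)"
instance
proof
  show "open (UNIV :: z2 set)" by (auto simp: open_z2_def intro: exI[of _ 1])
next
  fix S T :: "z2 set" assume ST: "open S" "open T"
  show "open (S \<inter> T)" unfolding open_z2_def
  proof
    fix u assume "u \<in> S \<inter> T"
    then obtain d e where "d > 0" "\<forall>v. z2_qnorm (v - u) < d \<longrightarrow> v \<in> S"
      "e > 0" "\<forall>v. z2_qnorm (v - u) < e \<longrightarrow> v \<in> T" 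
      using ST unfolding open_z2_def by blast
    then show "\<exists>e>0. \<forall>v. z2_qnorm (v - u) < e \<longrightarrow> v \<in> S \<inter> T"
      by (intro exI[of _ "min d e"]) auto
  qed
next
  fix K :: "z2 set set" assume K: "\<forall>S\<in>K. open S"
  show "open (\<Union>K)" unfolding open_z2_def
  proof
    fix u assume "u \<in> \<Union>K"
    then obtain S where S: "S \<in> K" "u \<in> S" by blast
    with K obtain e where "e > 0" "\<forall>v. z2_qnorm (v - u) < e \<longrightarrow> v \<in> S"
      unfolding open_z2_def by blast
    with S show "\<exists>e>0. \<forall>v. z2_qnorm (v - u) < e \<longrightarrow> v \<in> \<Union>K" by blast
  qed
qed
end

section \<open>Hyperplanes, isomorphisms and symplectic forms\<close>

definition hyperplane :: "'a::real_vector set \<Rightarrow> bool" where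
  "hyperplane H \<longleftrightarrow> (\<exists>f :: 'a \<Rightarrow> real. linear f \<and> (\<exists>u. f u \<noteq> 0) \<and> H = {u. f u = 0})"

definition isomorphism_into ::
  "('a::{real_vector,topological_space} \<Rightarrow> 'b::{real_vector,topological_space}) \<Rightarrow> bool" where
  "isomorphism_into f \<longleftrightarrow> linear f \<and> (\<exists>g. homeomorphism UNIV (range f) f g)"

definition symplectic_form :: "('a::banach \<Rightarrow> 'a \<Rightarrow> real) \<Rightarrow> bool" where
  "symplectic_form \<omega> \<longleftrightarrow>
     bounded_bilinear \<omega> \<and> (\<forall>x y. \<omega> x y = - \<omega> y x) \<and>
     (let L = (\<lambda>x. Blinfun (\<omega> x)) :: 'a \<Rightarrow> ('a \<Rightarrow>\<^sub>L real) in isomorphism_into L \<and> surj L)"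

definition bilinear_on :: "'a::real_vector set \<Rightarrow> ('a \<Rightarrow> 'a \<Rightarrow> real) \<Rightarrow> bool" where
  "bilinear_on H \<Omega> \<longleftrightarrow>
     (\<forall>u\<in>H. \<forall>v\<in>H. \<forall>w\<in>H. \<Omega> (u + v) w = \<Omega> u w + \<Omega> v w \<and> \<Omega> w (u + v) = \<Omega> w u + \<Omega> w v) \<and>
     (\<forall>u\<in>H. \<forall>w\<in>H. \<forall>c. \<Omega> (c *\<^sub>R u) w = c * \<Omega> u w \<and> \<Omega> w (c *\<^sub>R u) = c * \<Omega> w u)"

end

theory Submission
  imports Defs
begin

text \<open>
  A symplectic form identifies \<open>\<ell>\<^sub>2\<close> with its dual, so an extension \<open>\<Omega>\<close> provides functionals
  \<open>\<beta>\<^sub>n = \<Omega>(j g\<^sub>n, P \<cdot>)\<close> on \<open>Z\<^sub>2\<close>, with \<open>P\<close> a projection onto \<open>H\<close>, that are biorthogonal to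
  \<open>u\<^sub>n = j e\<^sub>n\<close>; both sequences have signed sums of \<open>N\<close> terms of size \<open>O(\<surd>N)\<close>. In other words
  \<open>Z\<^sub>2\<close> would contain a complemented copy of \<open>\<ell>\<^sub>2\<close>, and this is impossible:
  for disjoint \<open>v\<^sub>n\<close> in the unit ball of \<open>\<ell>\<^sub>2\<close> and \<open>V = \<Sum>\<^sub>n\<^sub>\<le>\<^sub>N \<epsilon>\<^sub>n v\<^sub>n\<close>, the vector
  \<open>(V log(|V|/\<surd>N), V)\<close> of \<open>Z\<^sub>2\<close> has size \<open>O(\<surd>N)\<close>, but it is
  \<open>\<Sum>\<^sub>n \<epsilon>\<^sub>n (v\<^sub>n log|v\<^sub>n|, v\<^sub>n) - log \<surd>N (V, 0)\<close>. Testing it against \<open>\<Sum>\<^sub>n \<epsilon>\<^sub>n \<beta>\<^sub>n\<close> with suitable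
  signs shows that \<open>\<beta>\<^sub>n(v\<^sub>n, 0)\<close> cannot stay bounded away from \<open>0\<close>. By a gliding hump this
  also holds for bounded, coordinatewise null \<open>v\<^sub>n\<close>. Applied to the functionals given by the
  natural symplectic form of \<open>Z\<^sub>2\<close> it forces the second components of \<open>u\<^sub>n\<close> to tend to \<open>0\<close>; then
  \<open>u\<^sub>n\<close> is asymptotically of the form \<open>(z\<^sub>n, 0)\<close>, and \<open>\<beta>\<^sub>n(u\<^sub>n) = 1\<close> is contradictory.
\<close>

section \<open>Vectors of \<open>\<ell>\<^sub>2\<close> and gliding humps\<close>

lemma ell2_nth_linear [simp]:
  "ell2_nth 0 n = 0"
  "ell2_nth (x + y) n = ell2_nth x n + ell2_nth y n"
  "ell2_nth (x - y) n = ell2_nth x n - ell2_nth y n"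
  "ell2_nth (c *\<^sub>R x) n = c * ell2_nth x n"
  by (transfer, simp)+

lemma ell2_nth_sum: "ell2_nth (\<Sum>i\<in>F. f i) n = (\<Sum>i\<in>F. ell2_nth (f i) n)"
  by (induction F rule: infinite_finite_induct) auto

lemma ell2_eqI: "(\<And>n. ell2_nth x n = ell2_nth y n) \<Longrightarrow> x = y"
  by transfer auto

lemma abs_ell2_nth_le: "\<bar>ell2_nth x n\<bar> \<le> norm x"
  by transfer (rule l2_nth_le)

lemma summable_ell2: "summable (\<lambda>n. (ell2_nth x n)\<^sup>2)"
  using ell2_nth[of x] by (simp add: l2_def)

lemma norm_ell2_sq: "(norm x)\<^sup>2 = (\<Sum>n. (ell2_nth x n)\<^sup>2)"
  using summable_ell2[of x] by (simp add: norm_ell2.rep_eq l2norm_def suminf_nonneg)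

lemma L2_set_le_norm_ell2:
  assumes "finite F" shows "L2_set (ell2_nth x) F \<le> norm x"
proof -
  have "(\<Sum>k\<in>F. (ell2_nth x k)\<^sup>2) \<le> (norm x)\<^sup>2"
    unfolding norm_ell2_sq by (intro sum_le_suminf summable_ell2 assms) auto
  then show ?thesis unfolding L2_set_def by (simp add: real_le_lsqrt)
qed

lemma sum_abs_mult_ell2_le:
  assumes "finite F"
  shows "(\<Sum>k\<in>F. \<bar>ell2_nth x k * ell2_nth y k\<bar>) \<le> norm x * norm y"
proof -
  have "(\<Sum>k\<in>F. \<bar>ell2_nth x k * ell2_nth y k\<bar>) \<le> L2_set (ell2_nth x) F * L2_set (ell2_nth y) F"
    using L2_set_mult_ineq[of "ell2_nth x" "ell2_nth y" F] by (simp add: abs_mult)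
  also have "\<dots> \<le> norm x * norm y"
    by (intro mult_mono L2_set_le_norm_ell2 assms) auto
  finally show ?thesis .
qed

lift_definition ell2_unit :: "nat \<Rightarrow> ell2" is "\<lambda>n k. if k = n then 1 else 0"
  by (auto simp: l2_def power2_eq_square if_distrib intro!: summable_finite[of "{_}"] cong: if_cong)

lift_definition ell2_restrict :: "nat set \<Rightarrow> ell2 \<Rightarrow> ell2" is "\<lambda>S x k. if k \<in> S then x k else 0"
  by (erule l2_dominated) auto

lemma norm_ell2_unit [simp]: "norm (ell2_unit n) = 1"
proof -
  have "(norm (ell2_unit n))\<^sup>2 = (\<Sum>k\<in>{n}. 1)"
    unfolding norm_ell2_sq by (subst suminf_finite[of "{n}"]) (auto simp: ell2_unit.rep_eq)
  then show ?thesis by (simp add: power2_eq_1_iff) (metis norm_ge_zero not_one_le_zero neg_0_le_iff_le)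
qed

lemma norm_add_disjoint:
  assumes "\<And>k. ell2_nth x k * ell2_nth y k = 0"
  shows "(norm (x + y))\<^sup>2 = (norm x)\<^sup>2 + (norm y)\<^sup>2"
proof -
  have "(ell2_nth (x + y) k)\<^sup>2 = (ell2_nth x k)\<^sup>2 + (ell2_nth y k)\<^sup>2" for k
    using assms[of k] by (auto simp: power2_sum)
  then show ?thesis
    unfolding norm_ell2_sq by (simp add: suminf_add summable_ell2)
qed

text \<open>Pythagoras, one summand at a time: disjoint supports make the squared norms add, and
  signs do not change them.\<close>

lemma norm_sum_disjoint:
  assumes "finite F" "\<And>n. \<bar>e n\<bar> = 1" "\<And>n. n \<in> F \<Longrightarrow> norm (v n) \<le> 1"
    and "\<And>m n k. m \<in> F \<Longrightarrow> n \<in> F \<Longrightarrow> m \<noteq> n \<Longrightarrow> ell2_nth (v m) k * ell2_nth (v n) k = 0"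
  shows "norm (\<Sum>n\<in>F. e n *\<^sub>R v n) \<le> sqrt (card F)"
proof -
  have "(norm (\<Sum>n\<in>F. e n *\<^sub>R v n))\<^sup>2 \<le> card F"
    using assms(1,3,4)
  proof (induction F rule: finite_induct)
    case (insert a F)
    have z: "ell2_nth (e a *\<^sub>R v a) k * ell2_nth (\<Sum>n\<in>F. e n *\<^sub>R v n) k = 0" for k
    proof -
      have "ell2_nth (v a) k * ell2_nth (v n) k = 0" if "n \<in> F" for n
        using insert.prems(2)[of a n k] insert.hyps that by auto
      then show ?thesis
        by (auto simp: ell2_nth_sum sum_distrib_left intro!: sum.neutral)
    qed
    have "norm (e a *\<^sub>R v a) \<le> 1" using assms(2)[of a] insert.prems(1)[of a] by simp
    then have "(norm (e a *\<^sub>R v a))\<^sup>2 \<le> 1" by (simp add: power_le_one)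
    moreover have "(norm (\<Sum>n\<in>F. e n *\<^sub>R v n))\<^sup>2 \<le> card F"
      by (intro insert.IH insert.prems) auto
    ultimately show ?case
      using insert.hyps norm_add_disjoint[OF z] by simp
  qed simp
  then show ?thesis by (rule real_le_rsqrt)
qed

lemma norm_restrict_finite:
  assumes "finite S"
  shows "(norm (ell2_restrict S x))\<^sup>2 = (\<Sum>k\<in>S. (ell2_nth x k)\<^sup>2)"
  unfolding norm_ell2_sq
  by (subst suminf_finite[OF assms]) (auto simp: ell2_restrict.rep_eq)

lemma norm_restrict_le: "norm (ell2_restrict S x) \<le> norm x"
proof -
  have "(norm (ell2_restrict S x))\<^sup>2 \<le> (norm x)\<^sup>2"
    unfolding norm_ell2_sq by (intro suminf_le summable_ell2) (auto simp: ell2_restrict.rep_eq)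
  then show ?thesis by simp
qed

lemma norm_restrict_tail_tendsto_0:
  "(\<lambda>m. norm (ell2_restrict {m..} x)) \<longlonglongrightarrow> 0"
proof -
  have "(norm (ell2_restrict {m..} x))\<^sup>2 = (norm x)\<^sup>2 - (\<Sum>k<m. (ell2_nth x k)\<^sup>2)" for m
  proof -
    have "ell2_restrict {..<m} x + ell2_restrict {m..} x = x"
      by (rule ell2_eqI) (auto simp: ell2_restrict.rep_eq)
    moreover have "(norm (ell2_restrict {..<m} x + ell2_restrict {m..} x))\<^sup>2
        = (norm (ell2_restrict {..<m} x))\<^sup>2 + (norm (ell2_restrict {m..} x))\<^sup>2"
      by (rule norm_add_disjoint) (auto simp: ell2_restrict.rep_eq)
    ultimately show ?thesis by (simp add: norm_restrict_finite)
  qed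
  moreover have "(\<lambda>m. (norm x)\<^sup>2 - (\<Sum>k<m. (ell2_nth x k)\<^sup>2)) \<longlonglongrightarrow> (norm x)\<^sup>2 - (norm x)\<^sup>2"
    unfolding norm_ell2_sq by (intro tendsto_intros summable_LIMSEQ summable_ell2)
  ultimately have "(\<lambda>m. sqrt ((norm (ell2_restrict {m..} x))\<^sup>2)) \<longlonglongrightarrow> sqrt 0"
    by (intro tendsto_real_sqrt) simp
  then show ?thesis by simp
qed

text \<open>A late \<open>z n\<close> has a small head because its coordinates tend to 0, and a
  small tail because it is square summable. The middle pieces, cut out on consecutive intervals, are
  disjoint.\<close>

lemma gliding_hump:
  assumes z: "\<And>k. (\<lambda>n. ell2_nth (z n) k) \<longlonglongrightarrow> 0" and d: "0 < d"
  shows "\<exists>(r :: nat \<Rightarrow> nat) v. strict_mono r \<and>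
    (\<forall>n. norm (v n) \<le> norm (z (r n))) \<and> (\<forall>n. norm (z (r n) - v n) \<le> d) \<and>
    (\<forall>m n k. m \<noteq> n \<longrightarrow> ell2_nth (v m) k * ell2_nth (v n) k = 0)"
proof -
  have head: "\<forall>\<^sub>F n in sequentially. norm (ell2_restrict {..<m} (z n)) < d/2" for m
  proof -
    have "(\<lambda>n. sqrt (\<Sum>k<m. (ell2_nth (z n) k)\<^sup>2)) \<longlonglongrightarrow> sqrt (\<Sum>k<m. 0\<^sup>2)"
      by (intro tendsto_intros z)
    moreover have "sqrt (\<Sum>k<m. (ell2_nth (z n) k)\<^sup>2) = norm (ell2_restrict {..<m} (z n))" for n
      by (simp flip: norm_restrict_finite)
    ultimately have "(\<lambda>n. norm (ell2_restrict {..<m} (z n))) \<longlonglongrightarrow> 0" by simp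
    then show ?thesis by (rule order_tendstoD) (use d in simp)
  qed
  have tail: "\<forall>\<^sub>F m in sequentially. norm (ell2_restrict {m..} (z n)) < d/2" for n
    by (rule order_tendstoD(2)[OF norm_restrict_tail_tendsto_0]) (use d in simp)
  \<comment> \<open>A state \<open>(r, m)\<close> holds the last index chosen and the end of its
    block. The next index must make the head below \<open>m\<close> small; only then is
    \<open>m'\<close> placed to cut off its tail.\<close>
  let ?Q = "\<lambda>(r::nat, m::nat) (r', m'). r < r' \<and> m < m' \<and>
    norm (ell2_restrict {..<m} (z r')) < d/2 \<and> norm (ell2_restrict {m'..} (z r')) < d/2"
  have "\<exists>f. \<forall>n. True \<and> ?Q (f n) (f (Suc n))"
  proof (rule dependent_nat_choice)
    fix p :: "nat \<times> nat" and n :: nat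
    obtain r m where p: "p = (r, m)" by force
    have "\<forall>\<^sub>F r' in sequentially. r < r' \<and> norm (ell2_restrict {..<m} (z r')) < d/2"
      by (intro eventually_conj head eventually_gt_at_top)
    then obtain r' where "r < r'" "norm (ell2_restrict {..<m} (z r')) < d/2"
      by (auto simp: eventually_sequentially)
    moreover have "\<forall>\<^sub>F m' in sequentially. m < m' \<and> norm (ell2_restrict {m'..} (z r')) < d/2"
      by (intro eventually_conj tail eventually_gt_at_top)
    then obtain m' where "m < m'" "norm (ell2_restrict {m'..} (z r')) < d/2"
      by (auto simp: eventually_sequentially)
    ultimately show "\<exists>q. True \<and> ?Q p q" using p by (intro exI[of _ "(r', m')"]) auto
  qed auto
  then obtain f where "\<forall>n. True \<and> ?Q (f n) (f (Suc n))" ..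
  then have f: "?Q (f n) (f (Suc n))" for n by (elim allE conjE)
  \<comment> \<open>The block of \<open>z (r n)\<close> ends at \<open>snd (f (Suc n))\<close> and
    begins at \<open>snd (f n)\<close>, hence the shift in \<open>r\<close> but not in
    \<open>m\<close>.\<close>
  define r where "r n = fst (f (Suc n))" for n
  define m where "m n = snd (f n)" for n
  define v where "v n = ell2_restrict {m n..<m (Suc n)} (z (r n))" for n
  have smm: "strict_mono m" unfolding strict_mono_Suc_iff m_def using f by (auto simp: case_prod_beta)
  show ?thesis
  proof (intro exI conjI allI impI)
    show "strict_mono r" unfolding strict_mono_Suc_iff r_def using f by (auto simp: case_prod_beta)
    show "norm (v n) \<le> norm (z (r n))" for n unfolding v_def by (rule norm_restrict_le)
    show "norm (z (r n) - v n) \<le> d" for n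
    proof -
      have "z (r n) - v n = ell2_restrict {..<m n} (z (r n)) + ell2_restrict {m (Suc n)..} (z (r n))"
        using strict_monoD[OF smm, of n "Suc n"]
        by (intro ell2_eqI) (auto simp: v_def ell2_restrict.rep_eq)
      moreover have "norm (ell2_restrict {..<m n} (z (r n))) < d/2"
        "norm (ell2_restrict {m (Suc n)..} (z (r n))) < d/2"
        using f[of n] by (auto simp: case_prod_beta r_def m_def)
      ultimately show ?thesis
        using norm_triangle_ineq[of "ell2_restrict {..<m n} (z (r n))" "ell2_restrict {m (Suc n)..} (z (r n))"]
        by simp
    qed
    show "ell2_nth (v a) k * ell2_nth (v b) k = 0" if "a \<noteq> b" for a b k
    proof -
      have "\<not> (m a \<le> k \<and> k < m (Suc a) \<and> m b \<le> k \<and> k < m (Suc b))"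
      proof (cases "a < b")
        case True
        then have "m (Suc a) \<le> m b" using smm by (simp add: strict_mono_less_eq)
        then show ?thesis by linarith
      next
        case False
        with that have "m (Suc b) \<le> m a" using smm by (simp add: strict_mono_less_eq)
        then show ?thesis by linarith
      qed
      then show ?thesis by (auto simp: v_def ell2_restrict.rep_eq)
    qed
  qed
qed

section \<open>The Kalton--Peck space\<close>

lemma abs_mult_ln_le_one:
  fixes t :: real assumes "0 \<le> t" "t \<le> 1" shows "\<bar>t * ln t\<bar> \<le> 1"
proof (cases "t = 0")
  case False
  with assms have t: "0 < t" by simp
  have "- ln t = ln (1 / t)" using t by (simp add: ln_div)
  also have "\<dots> \<le> 1 / t - 1" using t by (intro ln_le_minus_one) simp
  finally have "t * (- ln t) \<le> t * (1 / t - 1)" using t by (intro mult_left_mono) auto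
  also have "\<dots> \<le> 1" using t by (simp add: algebra_simps)
  finally have "- (t * ln t) \<le> 1" by simp
  moreover have "t * ln t \<le> 0" using t assms by (intro mult_nonneg_nonpos) auto
  ultimately show ?thesis by linarith
qed simp

text \<open>The bound on \<open>t * ln t\<close> for \<open>t = a / s\<close>. With \<open>a\<close>
  a coordinate it controls \<open>KP\<close>; with \<open>a\<close> a norm it controls the cost of
  normalising a vector by \<open>s\<close> instead of by its norm.\<close>

lemma abs_mult_ln_div_le:
  fixes a s :: real assumes "0 \<le> a" "a \<le> s" shows "\<bar>a * ln (a / s)\<bar> \<le> s"
proof (cases "s = 0")
  case False
  with assms have s: "0 < s" by simp
  then have "\<bar>a / s * ln (a / s)\<bar> \<le> 1" using assms by (intro abs_mult_ln_le_one) auto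
  then show ?thesis using s by (simp add: abs_mult field_simps)
qed (use assms in simp)

text \<open>Separates a coordinatewise nonlinear part from a multiple of \<open>x\<close>. The
  quotient under the logarithm can be split because a nonzero coordinate forces a nonzero
  norm.\<close>

lemma KP_eq:
  "KP (ell2_nth x) k = ell2_nth x k * ln \<bar>ell2_nth x k\<bar> - ell2_nth x k * ln (norm x)"
proof (cases "ell2_nth x k = 0")
  case False
  then have "norm x > 0" using abs_ell2_nth_le[of x k] by linarith
  then show ?thesis using False by (simp add: KP_def ln_div algebra_simps flip: norm_ell2.rep_eq)
qed (simp add: KP_def)

lemma abs_KP_le: "\<bar>KP (ell2_nth x) k\<bar> \<le> norm x"
  using abs_mult_ln_div_le[OF _ abs_ell2_nth_le, of x k]
  by (simp add: KP_def abs_mult norm_ell2.rep_eq)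

section \<open>Coordinates of \<open>z2\<close> as a twisted sum of two copies of
  \<open>\<ell>\<^sub>2\<close>\<close>

lift_definition z2_fst :: "z2 \<Rightarrow> nat \<Rightarrow> real" is fst .

lift_definition z2_quot :: "z2 \<Rightarrow> ell2" is snd
  by (auto simp: z2_carrier_def)

text \<open>The nonlinear component that turns the quasinorm into a sum of two
  \<open>\<ell>\<^sub>2\<close> norms: the deviation of \<open>u\<close> from the section
  \<open>z2_sec\<close> over its quotient part.\<close>

lift_definition z2_dev :: "z2 \<Rightarrow> ell2" is "\<lambda>(w, x) n. w n - KP x n"
  by (auto simp: z2_carrier_def)

lift_definition z2_incl :: "ell2 \<Rightarrow> z2" is "\<lambda>x. (x, \<lambda>n. 0)"
proof -
  fix x assume x: "x \<in> l2"
  have "Bseq x" by (rule BseqI'[of _ "l2norm x"]) (simp add: l2_nth_le[OF x])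
  then show "(x, \<lambda>n. 0) \<in> z2_carrier" using x by (simp add: z2_carrier_def KP_def)
qed

lift_definition z2_sec :: "ell2 \<Rightarrow> z2" is "\<lambda>x. (KP x, x)"
proof -
  fix x assume x: "x \<in> l2"
  have "\<bar>KP x n\<bar> \<le> l2norm x" for n
    using abs_KP_le[of "Abs_ell2 x" n] by (simp add: norm_ell2.rep_eq Abs_ell2_inverse[OF x])
  then have "Bseq (KP x)" by (intro BseqI'[of _ "l2norm x"]) simp
  then show "(KP x, x) \<in> z2_carrier" using x by (simp add: z2_carrier_def)
qed

lemma z2_eqI:
  "(\<And>n. z2_fst u n = z2_fst v n) \<Longrightarrow> (\<And>n. ell2_nth (z2_quot u) n = ell2_nth (z2_quot v) n) \<Longrightarrow> u = v"
  by transfer (auto simp: fun_eq_iff)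

lemma z2_fst_linear [simp]:
  "z2_fst 0 n = 0"
  "z2_fst (u + v) n = z2_fst u n + z2_fst v n"
  "z2_fst (u - v) n = z2_fst u n - z2_fst v n"
  "z2_fst (c *\<^sub>R u) n = c * z2_fst u n"
  by (transfer; auto)+

lemma z2_quot_linear [simp]:
  "z2_quot 0 = 0"
  "z2_quot (u + v) = z2_quot u + z2_quot v"
  "z2_quot (u - v) = z2_quot u - z2_quot v"
  "z2_quot (c *\<^sub>R u) = c *\<^sub>R z2_quot u"
  by (transfer; auto)+

lemma z2_fst_sum: "z2_fst (\<Sum>i\<in>F. f i) n = (\<Sum>i\<in>F. z2_fst (f i) n)"
  by (induction F rule: infinite_finite_induct) auto

lemma z2_quot_sum: "z2_quot (\<Sum>i\<in>F. f i) = (\<Sum>i\<in>F. z2_quot (f i))"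
  by (induction F rule: infinite_finite_induct) auto

lemma z2_proj_incl_sec [simp]:
  "z2_fst (z2_incl x) = ell2_nth x" "z2_quot (z2_incl x) = 0"
  "z2_fst (z2_sec x) = KP (ell2_nth x)" "z2_quot (z2_sec x) = x"
  by (transfer; simp)+

lemma z2_dev_nth: "ell2_nth (z2_dev u) n = z2_fst u n - KP (ell2_nth (z2_quot u)) n"
  by transfer auto

lemma linear_z2_incl: "linear z2_incl"
  by (rule linearI; rule z2_eqI) auto

lemma z2_decompose: "u = z2_incl (z2_dev u) + z2_sec (z2_quot u)"
  by (rule z2_eqI) (simp_all add: z2_dev_nth)

lemma z2_qnorm_eq: "z2_qnorm u = norm (z2_dev u) + norm (z2_quot u)"
  by transfer auto

lemma z2_qnorm_sec_add: "z2_qnorm (z2_sec x + z2_incl y) = norm y + norm x"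
proof -
  have "z2_dev (z2_sec x + z2_incl y) = y"
    by (rule ell2_eqI) (simp add: z2_dev_nth)
  then show ?thesis by (simp add: z2_qnorm_eq)
qed

lemma z2_qnorm_incl [simp]: "z2_qnorm (z2_incl x) = norm x"
proof -
  have "z2_dev (z2_incl x) = x"
    by (rule ell2_eqI) (simp add: z2_dev_nth KP_def)
  then show ?thesis by (simp add: z2_qnorm_eq)
qed

lemma z2_qnorm_sec [simp]: "z2_qnorm (z2_sec x) = norm x"
  using z2_qnorm_sec_add[of x 0] by (simp add: linear_0[OF linear_z2_incl])

lemma z2_qnorm_nonneg [simp]: "0 \<le> z2_qnorm u"
  by (simp add: z2_qnorm_eq)

lemma z2_qnorm_zero [simp]: "z2_qnorm 0 = 0"
  using z2_qnorm_incl[of 0] by (simp add: linear_0[OF linear_z2_incl])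

lemma z2_qnorm_eq_0: "z2_qnorm u = 0 \<longleftrightarrow> u = 0"
proof
  assume "z2_qnorm u = 0"
  then have "z2_dev u = 0" "z2_quot u = 0"
    by (simp_all add: z2_qnorm_eq add_nonneg_eq_0_iff)
  then show "u = 0"
    using z2_decompose[of u] by (auto intro!: z2_eqI simp: KP_def)
qed simp

lemma z2_qnorm_scaleR: "z2_qnorm (c *\<^sub>R u) = \<bar>c\<bar> * z2_qnorm u"
proof -
  have "ell2_nth (c *\<^sub>R z2_quot u) = (\<lambda>n. c * ell2_nth (z2_quot u) n)" by (simp add: fun_eq_iff)
  then have "KP (ell2_nth (c *\<^sub>R z2_quot u)) n = c * KP (ell2_nth (z2_quot u)) n" for n
    using KP_scale[OF ell2_nth] by simp
  then have "z2_dev (c *\<^sub>R u) = c *\<^sub>R z2_dev u"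
    by (intro ell2_eqI) (simp add: z2_dev_nth algebra_simps)
  then show ?thesis by (simp add: z2_qnorm_eq algebra_simps)
qed

lemma norm_quot_le_qnorm: "norm (z2_quot u) \<le> z2_qnorm u"
  by (simp add: z2_qnorm_eq)

lemma abs_fst_le_qnorm: "\<bar>z2_fst u k\<bar> \<le> z2_qnorm u"
  using abs_ell2_nth_le[of "z2_dev u" k] abs_KP_le[of "z2_quot u" k]
  unfolding z2_qnorm_eq z2_dev_nth by linarith

section \<open>The quasi-triangle inequality and neighbourhoods of 0\<close>

lemma norm_dominated_sum:
  assumes "\<And>n. \<bar>ell2_nth z n\<bar> \<le> \<bar>ell2_nth x n\<bar> + \<bar>ell2_nth y n\<bar>"
  shows "norm z \<le> norm x + norm y"
  unfolding norm_ell2.rep_eq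
proof (rule l2_bound)
  fix N
  have "L2_set (ell2_nth z) {..<N} \<le> L2_set (\<lambda>n. \<bar>ell2_nth x n\<bar> + \<bar>ell2_nth y n\<bar>) {..<N}"
    unfolding L2_set_def
    by (intro real_sqrt_le_mono sum_mono) (metis abs_ge_zero assms power2_abs power_mono)
  also have "\<dots> \<le> L2_set (\<lambda>n. \<bar>ell2_nth x n\<bar>) {..<N} + L2_set (\<lambda>n. \<bar>ell2_nth y n\<bar>) {..<N}"
    by (rule L2_set_triangle_ineq)
  also have "\<dots> \<le> l2norm (ell2_nth x) + l2norm (ell2_nth y)"
    using L2_set_le_l2norm[OF ell2_nth[of x], of N] L2_set_le_l2norm[OF ell2_nth[of y], of N]
    by (simp add: L2_set_def)
  finally show "L2_set (ell2_nth z) {..<N} \<le> l2norm (ell2_nth x) + l2norm (ell2_nth y)" .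
qed

text \<open>The deviation is the failure of additivity of \<open>KP\<close>. Normalising all three
  values of \<open>KP\<close> by the same \<open>norm x + norm y\<close> leaves the defect
  \<open>d\<close> of \<open>t * ln \<bar>t\<bar>\<close>, bounded by
  \<open>phi_quasi_additive\<close>, and three multiples of vectors, collected in \<open>r\<close>;
  each costs at most \<open>norm x + norm y\<close>.\<close>

lemma z2_dev_sec_add_le: "norm (z2_dev (z2_sec x + z2_sec y)) \<le> 4 * (norm x + norm y)"
proof -
  let ?s = "norm x + norm y"
  let ?phi = "\<lambda>t::real. t * ln \<bar>t\<bar>"
  define lam where "lam z = ln (norm z / ?s)" for z :: ell2
  define r where "r = lam (x + y) *\<^sub>R (x + y) - lam x *\<^sub>R x - lam y *\<^sub>R y"
  have small: "norm (lam z *\<^sub>R z) \<le> ?s" if "norm z \<le> ?s" for z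
    using abs_mult_ln_div_le[OF norm_ge_zero that] by (simp add: lam_def abs_mult mult.commute)
  have r: "norm r \<le> 3 * ?s"
    using small[of "x + y"] small[of x] small[of y] norm_triangle_ineq[of x y]
      norm_triangle_ineq4[of "lam (x + y) *\<^sub>R (x + y) - lam x *\<^sub>R x" "lam y *\<^sub>R y"]
      norm_triangle_ineq4[of "lam (x + y) *\<^sub>R (x + y)" "lam x *\<^sub>R x"]
    unfolding r_def by auto
  show ?thesis
  proof (cases "?s = 0")
    case False
    then have s: "0 < ?s" using norm_ge_zero[of x] norm_ge_zero[of y] by linarith
    have lam: "ell2_nth z k * ln (norm z) = ell2_nth z k * lam z + ell2_nth z k * ln ?s" for z k
    proof (cases "z = 0")
      case False
      then show ?thesis using s by (simp add: lam_def ln_div algebra_simps)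
    qed simp
    \<comment> \<open>The \<open>ln ?s\<close> terms given by \<open>lam\<close> cancel here, since
      coordinates are additive.\<close>
    define d where "d = z2_dev (z2_sec x + z2_sec y) - r"
    have d: "ell2_nth d k = ?phi (ell2_nth x k) + ?phi (ell2_nth y k) - ?phi (ell2_nth x k + ell2_nth y k)" for k
      using lam[of x k] lam[of y k] lam[of "x + y" k]
      by (simp add: d_def r_def z2_dev_nth KP_eq algebra_simps)
    have "norm d \<le> norm x + norm y"
    proof (rule norm_dominated_sum)
      show "\<bar>ell2_nth d k\<bar> \<le> \<bar>ell2_nth x k\<bar> + \<bar>ell2_nth y k\<bar>" for k
        using phi_quasi_additive[of "ell2_nth x k" "ell2_nth y k"] unfolding d by linarith
    qed
    then show ?thesis
      using r norm_triangle_ineq[of d r] by (simp add: d_def)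
  next
    case True
    then have "x = 0" "y = 0" by (simp_all add: add_nonneg_eq_0_iff)
    then have "z2_dev (z2_sec x + z2_sec y) = 0"
      by (intro ell2_eqI) (simp add: z2_dev_nth KP_def)
    then show ?thesis by simp
  qed
qed

text \<open>The constant is 4 from the deviation of the two sections plus 1 from the triangle
  inequality for the quotient parts.\<close>

lemma z2_qnorm_add_le: "z2_qnorm (u + v) \<le> 5 * (z2_qnorm u + z2_qnorm v)"
proof -
  let ?x = "z2_quot u" and ?y = "z2_quot v"
  have "z2_dev (u + v) = z2_dev u + z2_dev v + z2_dev (z2_sec ?x + z2_sec ?y)"
    by (rule ell2_eqI) (simp add: z2_dev_nth)
  then have "norm (z2_dev (u + v)) \<le> norm (z2_dev u) + norm (z2_dev v) + 4 * (norm ?x + norm ?y)"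
    using z2_dev_sec_add_le[of ?x ?y] norm_triangle_ineq[of "z2_dev u" "z2_dev v"]
      norm_triangle_ineq[of "z2_dev u + z2_dev v" "z2_dev (z2_sec ?x + z2_sec ?y)"] by simp
  then show ?thesis
    using norm_triangle_ineq[of ?x ?y] norm_ge_zero[of "z2_dev u"] norm_ge_zero[of "z2_dev v"]
    unfolding z2_qnorm_eq z2_quot_linear distrib_left by linarith
qed

text \<open>Quasinorm balls need not be open, but they are neighbourhoods of their centre.\<close>

lemma z2_qnorm_ball_nhd:
  obtains U where "open U" "0 \<in> U" "\<And>u. u \<in> U \<Longrightarrow> z2_qnorm u < 1"
proof
  define U where "U = {u. \<exists>e>0. \<forall>v. z2_qnorm (v - u) < e \<longrightarrow> z2_qnorm v < 1}"
  show "open U" unfolding open_z2_def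
  proof
    fix u assume "u \<in> U"
    then obtain e where e: "0 < e" "\<And>v. z2_qnorm (v - u) < e \<Longrightarrow> z2_qnorm v < 1"
      by (auto simp: U_def)
    \<comment> \<open>Two steps of length \<open>e/10\<close> stay within \<open>e\<close>, as the
      quasi-triangle inequality costs a factor 5.\<close>
    have "v \<in> U" if v: "z2_qnorm (v - u) < e/10" for v
      unfolding U_def
    proof (intro CollectI exI conjI allI impI)
      show "0 < e/10" using e by simp
      fix w assume w: "z2_qnorm (w - v) < e/10"
      have "z2_qnorm (w - u) \<le> 5 * (z2_qnorm (w - v) + z2_qnorm (v - u))"
        using z2_qnorm_add_le[of "w - v" "v - u"] by simp
      also have "\<dots> < 5 * (e/10 + e/10)" using v w by (intro mult_strict_left_mono add_strict_mono) auto
      finally show "z2_qnorm w < 1" by (intro e) simp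
    qed
    then show "\<exists>e>0. \<forall>v. z2_qnorm (v - u) < e \<longrightarrow> v \<in> U"
      using e(1) by (intro exI[of _ "e/10"]) auto
  qed
  show "0 \<in> U" by (auto simp: U_def intro: exI[of _ 1])
  show "z2_qnorm u < 1" if "u \<in> U" for u
    using that by (auto simp: U_def)
qed

section \<open>The natural symplectic pairing of \<open>z2\<close>\<close>

lemma abs_mult_ln_quotient_le:
  fixes a b :: real
  assumes "0 < a" "0 < b" shows "a * b * \<bar>ln a - ln b\<bar> \<le> a\<^sup>2 + b\<^sup>2"
proof -
  have *: "s * t * (ln s - ln t) \<le> s\<^sup>2 + t\<^sup>2" if "0 < s" "0 < t" for s t :: real
  proof -
    have "ln s - ln t \<le> s / t - 1"
      using ln_le_minus_one[of "s / t"] that by (simp add: ln_div)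
    also have "\<dots> \<le> s / t" by simp
    finally have "s * t * (ln s - ln t) \<le> s * t * (s / t)"
      using that by (intro mult_left_mono) auto
    also have "\<dots> = s\<^sup>2" using that by (simp add: power2_eq_square)
    finally show ?thesis by (smt (verit) zero_le_power2)
  qed
  show ?thesis
  proof (cases "ln a \<ge> ln b")
    case True then show ?thesis using *[of a b] assms by simp
  next
    case False then show ?thesis using *[of b a] assms by (simp add: mult.commute add.commute)
  qed
qed

text \<open>Antisymmetry leaves only the difference of two normalised logarithms, which
  \<open>abs_mult_ln_quotient_le\<close> turns into squares. The weights make each of the two sums
  of squares contribute at most \<open>norm x * norm y\<close>.\<close>

lemma KP_antisymmetric_le:
  assumes "0 < norm x" "0 < norm y"
  shows "\<bar>KP (ell2_nth x) k * ell2_nth y k - ell2_nth x k * KP (ell2_nth y) k\<bar>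
    \<le> norm y / norm x * (ell2_nth x k)\<^sup>2 + norm x / norm y * (ell2_nth y k)\<^sup>2"
proof (cases "ell2_nth x k = 0 \<or> ell2_nth y k = 0")
  case True
  then show ?thesis by (auto simp: KP_def)
next
  case False
  let ?a = "\<bar>ell2_nth x k\<bar> / norm x" and ?b = "\<bar>ell2_nth y k\<bar> / norm y"
  have "KP (ell2_nth x) k * ell2_nth y k - ell2_nth x k * KP (ell2_nth y) k
      = ell2_nth x k * ell2_nth y k * (ln ?a - ln ?b)"
    by (simp add: KP_def norm_ell2.rep_eq algebra_simps)
  then have "\<bar>KP (ell2_nth x) k * ell2_nth y k - ell2_nth x k * KP (ell2_nth y) k\<bar>
      = norm x * norm y * (?a * ?b * \<bar>ln ?a - ln ?b\<bar>)"
    using assms by (simp add: abs_mult)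
  also have "\<dots> \<le> norm x * norm y * (?a\<^sup>2 + ?b\<^sup>2)"
    using assms False by (intro mult_left_mono abs_mult_ln_quotient_le) auto
  also have "\<dots> = norm y / norm x * (ell2_nth x k)\<^sup>2 + norm x / norm y * (ell2_nth y k)\<^sup>2"
    using assms by (simp add: power2_eq_square field_simps)
  finally show ?thesis .
qed

lemma KP_antisymmetric_sum_le:
  "(\<Sum>k<m. \<bar>KP (ell2_nth x) k * ell2_nth y k - ell2_nth x k * KP (ell2_nth y) k\<bar>)
    \<le> 2 * (norm x * norm y)"
proof (cases "x = 0 \<or> y = 0")
  case True
  then show ?thesis by (auto simp: KP_def)
next
  case False
  then have p: "0 < norm x" "0 < norm y" by auto
  have sq: "(\<Sum>k<m. (ell2_nth z k)\<^sup>2) \<le> (norm z)\<^sup>2" for z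
    unfolding norm_ell2_sq by (intro sum_le_suminf summable_ell2) auto
  have "(\<Sum>k<m. \<bar>KP (ell2_nth x) k * ell2_nth y k - ell2_nth x k * KP (ell2_nth y) k\<bar>)
     \<le> (\<Sum>k<m. norm y / norm x * (ell2_nth x k)\<^sup>2 + norm x / norm y * (ell2_nth y k)\<^sup>2)"
    by (intro sum_mono KP_antisymmetric_le p)
  also have "\<dots> = norm y / norm x * (\<Sum>k<m. (ell2_nth x k)\<^sup>2) + norm x / norm y * (\<Sum>k<m. (ell2_nth y k)\<^sup>2)"
    by (simp add: sum.distrib sum_distrib_left)
  also have "\<dots> \<le> norm y / norm x * (norm x)\<^sup>2 + norm x / norm y * (norm y)\<^sup>2"
    using p by (intro add_mono mult_left_mono sq) auto
  also have "\<dots> = 2 * (norm x * norm y)"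
    using p by (simp add: power2_eq_square field_simps)
  finally show ?thesis .
qed

text \<open>The two products stay under one sum because each series alone may diverge.\<close>

definition z2_pairing :: "z2 \<Rightarrow> z2 \<Rightarrow> real" where
  "z2_pairing u v = (\<Sum>k. ell2_nth (z2_quot u) k * z2_fst v k - z2_fst u k * ell2_nth (z2_quot v) k)"

text \<open>Writing first components as \<open>z2_dev\<close> plus \<open>KP\<close>, the deviation
  terms fall under Cauchy-Schwarz and the \<open>KP\<close> terms form the antisymmetric
  combination. One bound on the partial sums of absolute values yields both claims.\<close>

lemma z2_pairing_summable_bound:
  defines "t u v k \<equiv> ell2_nth (z2_quot u) k * z2_fst v k - z2_fst u k * ell2_nth (z2_quot v) k"
  shows "summable (t u v)" and "\<bar>z2_pairing u v\<bar> \<le> 2 * z2_qnorm u * z2_qnorm v"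
proof -
  let ?x = "z2_quot u" and ?y = "z2_quot v"
  have b: "(\<Sum>k<m. \<bar>t u v k\<bar>) \<le> 2 * z2_qnorm u * z2_qnorm v" for m
  proof -
    let ?K = "\<lambda>k. KP (ell2_nth ?x) k * ell2_nth ?y k - ell2_nth ?x k * KP (ell2_nth ?y) k"
    have "(\<Sum>k<m. \<bar>t u v k\<bar>) \<le> (\<Sum>k<m. \<bar>ell2_nth ?x k * ell2_nth (z2_dev v) k\<bar>
        + \<bar>ell2_nth (z2_dev u) k * ell2_nth ?y k\<bar> + \<bar>?K k\<bar>)"
    proof (rule sum_mono)
      fix k
      have "t u v k = ell2_nth ?x k * ell2_nth (z2_dev v) k
          - ell2_nth (z2_dev u) k * ell2_nth ?y k - ?K k"
        by (simp add: t_def z2_dev_nth algebra_simps)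
      then show "\<bar>t u v k\<bar> \<le> \<bar>ell2_nth ?x k * ell2_nth (z2_dev v) k\<bar>
        + \<bar>ell2_nth (z2_dev u) k * ell2_nth ?y k\<bar> + \<bar>?K k\<bar>" by linarith
    qed
    also have "\<dots> \<le> norm ?x * norm (z2_dev v) + norm (z2_dev u) * norm ?y + 2 * (norm ?x * norm ?y)"
      unfolding sum.distrib
      by (intro add_mono sum_abs_mult_ell2_le KP_antisymmetric_sum_le) auto
    also have "\<dots> \<le> 2 * z2_qnorm u * z2_qnorm v"
    proof -
      have "0 \<le> norm ?x * norm (z2_dev v)" "0 \<le> norm (z2_dev u) * norm ?y"
        "0 \<le> norm (z2_dev u) * norm (z2_dev v)" by simp_all
      then show ?thesis by (simp add: z2_qnorm_eq algebra_simps)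
    qed
    finally show ?thesis .
  qed
  have s: "summable (\<lambda>k. \<bar>t u v k\<bar>)"
    by (rule summableI_nonneg_bounded[OF _ b]) simp
  then show "summable (t u v)" by (rule summable_rabs_cancel)
  have "\<bar>z2_pairing u v\<bar> \<le> (\<Sum>k. \<bar>t u v k\<bar>)"
    unfolding z2_pairing_def t_def[symmetric] by (rule summable_rabs[OF s])
  also have "\<dots> \<le> 2 * z2_qnorm u * z2_qnorm v" by (rule suminf_le_const[OF s b])
  finally show "\<bar>z2_pairing u v\<bar> \<le> 2 * z2_qnorm u * z2_qnorm v" .
qed

lemma linear_z2_pairing_left: "linear (\<lambda>u. z2_pairing u v)"
proof (rule linearI)
  fix u u' :: z2 and c :: real
  show "z2_pairing (u + u') v = z2_pairing u v + z2_pairing u' v"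
    unfolding z2_pairing_def
    by (subst suminf_add[OF z2_pairing_summable_bound(1) z2_pairing_summable_bound(1)])
      (simp add: algebra_simps)
  show "z2_pairing (c *\<^sub>R u) v = c *\<^sub>R z2_pairing u v"
    unfolding z2_pairing_def real_scaleR_def
    by (subst suminf_mult[OF z2_pairing_summable_bound(1), symmetric])
      (simp add: algebra_simps)
qed

lemma z2_pairing_swap: "z2_pairing u v = - z2_pairing v u"
  unfolding z2_pairing_def suminf_minus[OF z2_pairing_summable_bound(1), symmetric]
  by (simp add: mult.commute)

lemma linear_z2_pairing_right: "linear (z2_pairing u)"
  using linear_compose_neg[OF linear_z2_pairing_left[of u]]
  by (simp flip: z2_pairing_swap)

text \<open>This is how the pairing detects the quotient part of \<open>u\<close> on vectors of the
  form \<open>z2_incl\<close>.\<close>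

lemma z2_pairing_incl_quot: "z2_pairing u (z2_incl (z2_quot u)) = (norm (z2_quot u))\<^sup>2"
  unfolding z2_pairing_def norm_ell2_sq by (simp add: power2_eq_square)

section \<open>Signed sums and logarithmic growth\<close>

text \<open>An upper 2-estimate on signed sums. The gauge \<open>p\<close> is arbitrary so that the
  same notion serves for absolute values, norms and the quasinorm.\<close>

definition sign_bounded :: "('a::real_vector \<Rightarrow> real) \<Rightarrow> real \<Rightarrow> (nat \<Rightarrow> 'a) \<Rightarrow> bool" where
  "sign_bounded p C a \<longleftrightarrow>
    (\<forall>F e. finite F \<longrightarrow> (\<forall>n. \<bar>e n\<bar> = 1) \<longrightarrow> p (\<Sum>n\<in>F. e n *\<^sub>R a n) \<le> C * sqrt (card F))"

lemma sign_boundedD: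
  "sign_bounded p C a \<Longrightarrow> finite F \<Longrightarrow> (\<And>n. \<bar>e n\<bar> = 1) \<Longrightarrow>
    p (\<Sum>n\<in>F. e n *\<^sub>R a n) \<le> C * sqrt (card F)"
  by (auto simp: sign_bounded_def)

lemma sign_bounded_single: "sign_bounded p C a \<Longrightarrow> p (a n) \<le> C"
  using sign_boundedD[of p C a "{n}" "\<lambda>_. 1"] by simp

lemma sign_bounded_subseq:
  fixes r :: "nat \<Rightarrow> nat"
  assumes "sign_bounded p C a" "inj r"
  shows "sign_bounded p C (\<lambda>n. a (r n))"
  unfolding sign_bounded_def
proof (intro allI impI)
  fix F :: "nat set" and e :: "nat \<Rightarrow> real"
  assume F: "finite F" "\<forall>n. \<bar>e n\<bar> = 1"
  have inj: "inj_on r F" using assms(2) by (rule inj_on_subset) auto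
  have "(\<Sum>n\<in>F. e n *\<^sub>R a (r n)) = (\<Sum>n\<in>r ` F. e (inv r n) *\<^sub>R a n)"
    by (simp add: sum.reindex[OF inj] assms(2))
  then show "p (\<Sum>n\<in>F. e n *\<^sub>R a (r n)) \<le> C * sqrt (card F)"
    using sign_boundedD[OF assms(1), of "r ` F" "\<lambda>n. e (inv r n)"] F
    by (simp add: card_image[OF inj])
qed

lemma sign_bounded_image:
  assumes "sign_bounded p C a" "linear f" "\<And>x. p' (f x) \<le> D * p x" "0 \<le> D"
  shows "sign_bounded p' (D * C) (\<lambda>n. f (a n))"
  unfolding sign_bounded_def
proof (intro allI impI)
  fix F :: "nat set" and e :: "nat \<Rightarrow> real"
  assume F: "finite F" "\<forall>n. \<bar>e n\<bar> = 1"
  have "p' (\<Sum>n\<in>F. e n *\<^sub>R f (a n)) = p' (f (\<Sum>n\<in>F. e n *\<^sub>R a n))"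
    by (simp add: linear_sum[OF assms(2)] linear_scale[OF assms(2)])
  also have "\<dots> \<le> D * p (\<Sum>n\<in>F. e n *\<^sub>R a n)" by (rule assms(3))
  also have "\<dots> \<le> D * (C * sqrt (card F))"
    using F assms by (intro mult_left_mono sign_boundedD) auto
  finally show "p' (\<Sum>n\<in>F. e n *\<^sub>R f (a n)) \<le> D * C * sqrt (card F)" by (simp add: mult.assoc)
qed

text \<open>If \<open>N\<close> terms have modulus at least \<open>e\<close>, giving them matching
  signs yields \<open>e * N \<le> C * sqrt N\<close>, so \<open>N\<close> is bounded by
  \<open>(C / e)\<^sup>2\<close>.\<close>

lemma sign_bounded_real_tendsto_0:
  fixes a :: "nat \<Rightarrow> real"
  assumes sb: "sign_bounded abs C a"
  shows "a \<longlonglongrightarrow> 0"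
proof (rule tendstoI)
  fix e :: real assume e: "0 < e"
  have fin: "finite {n. e \<le> \<bar>a n\<bar>}"
  proof (rule ccontr)
    assume "infinite {n. e \<le> \<bar>a n\<bar>}"
    define N where "N = nat \<lceil>(C / e)\<^sup>2\<rceil> + 1"
    obtain F where F: "finite F" "card F = N" "F \<subseteq> {n. e \<le> \<bar>a n\<bar>}"
      using infinite_arbitrarily_large[OF \<open>infinite _\<close>, of N] by auto
    have "e * N = (\<Sum>n\<in>F. e)" using F by simp
    also have "\<dots> \<le> (\<Sum>n\<in>F. \<bar>a n\<bar>)" using F by (intro sum_mono) auto
    also have "\<dots> = (\<Sum>n\<in>F. (if 0 \<le> a n then 1 else - 1) *\<^sub>R a n)" by (intro sum.cong) auto
    also have "\<dots> \<le> C * sqrt (card F)"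
      using sign_boundedD[OF sb F(1), of "\<lambda>n. if 0 \<le> a n then 1 else - 1"] by (simp add: abs_le_iff)
    finally have "e * (sqrt N * sqrt N) \<le> C * sqrt N" using F by simp
    moreover have "0 < N" by (simp add: N_def)
    then have "0 < sqrt N" by simp
    ultimately have "e * sqrt N \<le> C" by (metis mult.assoc mult_le_cancel_right_pos)
    then have "sqrt N \<le> C / e" using e by (simp add: field_simps)
    then have "N \<le> (C / e)\<^sup>2" by (rule sqrt_le_D)
    moreover have "(C / e)\<^sup>2 < N" unfolding N_def by linarith
    ultimately show False by simp
  qed
  then show "\<forall>\<^sub>F n in sequentially. dist (a n) 0 < e"
    by (simp add: eventually_cofinite not_less flip: cofinite_eq_sequentially)
qed

text \<open>The diagonal is the average of the double sum over all signs, so some choice reaches it.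
  The induction picks the signs one by one.\<close>

lemma ex_signs_diagonal_le:
  fixes b :: "nat \<Rightarrow> nat \<Rightarrow> real"
  shows "\<exists>e::nat \<Rightarrow> real. (\<forall>n. \<bar>e n\<bar> = 1) \<and> (\<Sum>n<N. b n n) \<le> (\<Sum>m<N. \<Sum>n<N. e m * e n * b m n)"
proof (induction N)
  case 0
  show ?case by (intro exI[of _ "\<lambda>_. 1"]) simp
next
  case (Suc N)
  then obtain e :: "nat \<Rightarrow> real" where e: "\<And>n. \<bar>e n\<bar> = 1"
    "(\<Sum>n<N. b n n) \<le> (\<Sum>m<N. \<Sum>n<N. e m * e n * b m n)" by blast
  \<comment> \<open>The off-diagonal entries of the new row and column, without the new sign.
    Choosing \<open>s\<close> to agree with \<open>x\<close> makes their contribution nonnegative,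
    while the diagonal entry keeps the factor \<open>s * s = 1\<close>.\<close>
  define x where "x = (\<Sum>m<N. e m * b m N) + (\<Sum>n<N. e n * b N n)"
  define s :: real where "s = (if 0 \<le> x then 1 else - 1)"
  have s: "0 \<le> s * x" "s * s = 1" "\<bar>s\<bar> = 1" by (auto simp: s_def)
  let ?e = "e(N := s)"
  have "(\<Sum>m<Suc N. \<Sum>n<Suc N. ?e m * ?e n * b m n)
      = (\<Sum>m<N. \<Sum>n<N. ?e m * ?e n * b m n) + (\<Sum>m<N. ?e m * s * b m N)
        + (\<Sum>n<N. s * ?e n * b N n) + s * s * b N N"
    by (simp add: sum.distrib)
  also have "\<dots> = (\<Sum>m<N. \<Sum>n<N. e m * e n * b m n) + s * x + b N N"
    unfolding x_def distrib_left sum_distrib_left s(2)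
    by (simp add: algebra_simps)
  finally show ?case using e s by (intro exI[of _ ?e]) auto
qed

text \<open>The vector \<open>(x ln |x|, x)\<close>: the added term undoes the normalisation in
  \<open>KP\<close>. This makes it additive on signed sums of disjoint vectors.\<close>

definition z2_log :: "ell2 \<Rightarrow> z2" where
  "z2_log x = z2_sec x + ln (norm x) *\<^sub>R z2_incl x"

lemma z2_log_proj [simp]:
  "z2_fst (z2_log x) k = ell2_nth x k * ln \<bar>ell2_nth x k\<bar>" "z2_quot (z2_log x) = x"
  by (simp_all add: z2_log_def KP_eq)

text \<open>At each coordinate at most one summand is nonzero, and
  \<open>t * ln \<bar>t\<bar>\<close> is odd and vanishes at 0.\<close>

lemma z2_log_sum_disjoint:
  assumes "finite F" "\<And>n. \<bar>e n\<bar> = 1"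
    and disj: "\<And>m n k. m \<noteq> n \<Longrightarrow> ell2_nth (v m) k * ell2_nth (v n) k = 0"
  shows "z2_log (\<Sum>n\<in>F. e n *\<^sub>R v n) = (\<Sum>n\<in>F. e n *\<^sub>R z2_log (v n))"
proof (rule z2_eqI)
  fix k
  let ?phi = "\<lambda>t::real. t * ln \<bar>t\<bar>" and ?a = "\<lambda>n. ell2_nth (v n) k"
  have "?phi (\<Sum>n\<in>F. e n * ?a n) = (\<Sum>n\<in>F. e n * ?phi (?a n))"
  proof (cases "\<exists>m\<in>F. ?a m \<noteq> 0")
    case True
    then obtain m where m: "m \<in> F" "?a m \<noteq> 0" by blast
    have z: "?a n = 0" if "n \<noteq> m" for n using disj[OF that, of k] m by auto
    have single: "(\<Sum>n\<in>F. e n * g (?a n)) = e m * g (?a m)" if "g 0 = 0" for g :: "real \<Rightarrow> real"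
      using m assms(1) z that by (subst sum.remove[of _ m]) (auto intro!: sum.neutral)
    show ?thesis using single[of "\<lambda>t. t"] single[of ?phi] by (simp add: abs_mult assms(2))
  qed simp
  then show "z2_fst (z2_log (\<Sum>n\<in>F. e n *\<^sub>R v n)) k = z2_fst (\<Sum>n\<in>F. e n *\<^sub>R z2_log (v n)) k"
    by (simp add: ell2_nth_sum z2_fst_sum)
qed (simp add: z2_quot_sum)

text \<open>The correction replaces the normalisation by \<open>norm x\<close> with one by
  \<open>s\<close>. What remains is \<open>z2_sec x\<close> and a multiple of \<open>x\<close> in
  the kernel, each of size at most \<open>s\<close>.\<close>

lemma z2_qnorm_log_le:
  assumes "norm x \<le> s" "0 < s"
  shows "z2_qnorm (z2_log x - ln s *\<^sub>R z2_incl x) \<le> 2 * s"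
proof -
  have "z2_log x - ln s *\<^sub>R z2_incl x = z2_sec x + z2_incl ((ln (norm x) - ln s) *\<^sub>R x)"
    by (simp add: z2_log_def linear_scale[OF linear_z2_incl] linear_diff[OF linear_z2_incl] algebra_simps)
  then have "z2_qnorm (z2_log x - ln s *\<^sub>R z2_incl x) = norm ((ln (norm x) - ln s) *\<^sub>R x) + norm x"
    by (simp only: z2_qnorm_sec_add)
  moreover have "norm ((ln (norm x) - ln s) *\<^sub>R x) \<le> s"
  proof (cases "x = 0")
    case False
    then show ?thesis
      using abs_mult_ln_div_le[OF norm_ge_zero assms(1)] assms
      by (simp add: ln_div abs_mult mult.commute)
  qed (use assms in simp)
  ultimately show ?thesis using assms by simp
qed

text \<open>The double sum of \<open>- \<beta> m (w n)\<close> with suitable signs dominates its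
  diagonal, which is at least \<open>N * (c * L - 2 * C)\<close>. It is at most
  \<open>2 * C * N\<close>, because the signed sum of the \<open>w n\<close> has quasinorm at most
  \<open>2 * sqrt N\<close>.\<close>

lemma log_growth_bound:
  fixes \<beta> :: "nat \<Rightarrow> z2 \<Rightarrow> real" and N :: nat
  assumes lin: "\<And>n. linear (\<beta> n)"
    and sb: "\<And>u. sign_bounded abs (C * z2_qnorm u) (\<lambda>n. \<beta> n u)" and C: "0 \<le> C"
    and v: "\<And>n. norm (v n) \<le> 1"
    and disj: "\<And>m n k. m \<noteq> n \<Longrightarrow> ell2_nth (v m) k * ell2_nth (v n) k = 0"
    and c: "\<And>n. c \<le> \<beta> n (z2_incl (v n))" and N: "0 < N"
  shows "c * ln (sqrt N) \<le> 4 * C"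
proof -
  \<comment> \<open>The logarithm of the bound \<open>sqrt N\<close> on the norm of
    \<open>V\<close>, so that the signed sum of the \<open>w n\<close> is \<open>z2_log V\<close>
    normalised by \<open>sqrt N\<close>.\<close>
  define L where "L = ln (sqrt N)"
  have L: "0 \<le> L" using N by (simp add: L_def Suc_le_eq)
  define w where "w n = z2_log (v n) - L *\<^sub>R z2_incl (v n)" for n
  obtain e where e: "\<And>n. \<bar>e n\<bar> = (1::real)"
    and diag: "(\<Sum>n<N. - \<beta> n (w n)) \<le> (\<Sum>m<N. \<Sum>n<N. e m * e n * - \<beta> m (w n))"
    using ex_signs_diagonal_le[of "\<lambda>m n. - \<beta> m (w n)" N] by blast
  define V where "V = (\<Sum>n<N. e n *\<^sub>R v n)"
  have V: "norm V \<le> sqrt N"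
    using norm_sum_disjoint[of "{..<N}" e v] e v disj by (simp add: V_def)
  have W: "(\<Sum>n<N. e n *\<^sub>R w n) = z2_log V - L *\<^sub>R z2_incl V"
    using e unfolding V_def w_def
    by (subst z2_log_sum_disjoint[OF _ e disj])
      (auto simp: linear_sum[OF linear_z2_incl] linear_scale[OF linear_z2_incl]
         sum_subtractf scaleR_sum_right scaleR_diff_right mult.commute)
  have "(\<Sum>m<N. \<Sum>n<N. e m * e n * - \<beta> m (w n)) = - (\<Sum>m<N. e m *\<^sub>R \<beta> m (\<Sum>n<N. e n *\<^sub>R w n))"
    by (simp add: linear_sum[OF lin] linear_scale[OF lin] sum_distrib_left sum_negf mult.assoc)
  also have "\<dots> \<le> (C * z2_qnorm (\<Sum>n<N. e n *\<^sub>R w n)) * sqrt N"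
    using sign_boundedD[OF sb[of "\<Sum>n<N. e n *\<^sub>R w n"], of "{..<N}" e] e by simp
  also have "\<dots> \<le> (C * (2 * sqrt N)) * sqrt N"
    unfolding W L_def using C N V by (intro mult_right_mono mult_left_mono z2_qnorm_log_le) auto
  also have "\<dots> = 2 * C * N" by simp
  finally have off: "(\<Sum>n<N. - \<beta> n (w n)) \<le> 2 * C * N" using diag by simp
  have "c * L - 2 * C \<le> - \<beta> n (w n)" for n
  proof -
    have "\<bar>\<beta> n (z2_log (v n))\<bar> \<le> C * z2_qnorm (z2_log (v n))"
      by (rule sign_bounded_single[OF sb])
    \<comment> \<open>The case \<open>s = 1\<close>, where the correction \<open>ln s\<close>
      vanishes.\<close>
    also have "\<dots> \<le> C * 2"
      using z2_qnorm_log_le[OF v[of n]] C by (intro mult_left_mono) auto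
    finally have "\<beta> n (z2_log (v n)) \<le> C * 2" by simp
    moreover have "c * L \<le> L * \<beta> n (z2_incl (v n))"
      using mult_left_mono[OF c L, of n] by (simp add: mult.commute)
    moreover have "\<beta> n (w n) = \<beta> n (z2_log (v n)) - L * \<beta> n (z2_incl (v n))"
      by (simp add: w_def linear_diff[OF lin] linear_scale[OF lin])
    ultimately show ?thesis by linarith
  qed
  then have "(\<Sum>n<N. c * L - 2 * C) \<le> (\<Sum>n<N. - \<beta> n (w n))" by (intro sum_mono)
  with off have "N * (c * L - 2 * C) \<le> N * (2 * C)" by (simp add: mult.commute mult.left_commute)
  then show ?thesis using N by (simp add: L_def)
qed

text \<open>After a gliding hump and a rescaling into the unit ball, \<open>log_growth_bound\<close>
  would hold for every \<open>N\<close> with the same constants, although \<open>ln (sqrt N)\<close>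
  is unbounded.\<close>

lemma sign_bounded_incl_not_bounded_below:
  fixes \<beta> :: "nat \<Rightarrow> z2 \<Rightarrow> real"
  assumes lin: "\<And>n. linear (\<beta> n)"
    and sb: "\<And>u. sign_bounded abs (C * z2_qnorm u) (\<lambda>n. \<beta> n u)" and C: "0 \<le> C"
    and z: "\<And>n. norm (z n) \<le> M" "\<And>k. (\<lambda>n. ell2_nth (z n) k) \<longlonglongrightarrow> 0"
    and c: "0 < c" "\<And>n. c \<le> \<beta> n (z2_incl (z n))"
  shows False
proof -
  \<comment> \<open>Chosen so that replacing \<open>z (r n)\<close> by its disjoint piece changes
    the functional by at most \<open>c/2\<close>; the \<open>+ 1\<close> covers
    \<open>C = 0\<close>.\<close>
  define d where "d = c / 2 / (C + 1)"
  have d0: "0 < d" using c C by (simp add: d_def)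
  have "C * d \<le> d * (C + 1)" using d0 by (simp add: mult.commute distrib_right)
  also have "\<dots> = c/2" using C by (auto simp: d_def simp del: divide_divide_eq_left)
  finally have Cd: "C * d \<le> c/2" .
  obtain r :: "nat \<Rightarrow> nat" and v where r: "strict_mono r"
    and v: "\<And>n. norm (v n) \<le> norm (z (r n))" "\<And>n. norm (z (r n) - v n) \<le> d"
    and disj: "\<And>m n k. m \<noteq> n \<Longrightarrow> ell2_nth (v m) k * ell2_nth (v n) k = 0"
    using gliding_hump[OF z(2) d0] by blast
  define K where "K = \<bar>M\<bar> + 1"
  have K: "0 < K" by (simp add: K_def)
  have low: "c / (2 * K) * ln (sqrt N) \<le> 4 * C" if "0 < N" for N :: nat
  proof (rule log_growth_bound[where \<beta> = "\<lambda>n. \<beta> (r n)" and v = "\<lambda>n. (1 / K) *\<^sub>R v n"])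
    show "sign_bounded abs (C * z2_qnorm u) (\<lambda>n. \<beta> (r n) u)" for u
      using sign_bounded_subseq[OF sb strict_mono_imp_inj_on[OF r]] .
    show "norm ((1 / K) *\<^sub>R v n) \<le> 1" for n
      using v(1)[of n] z(1)[of "r n"] K by (simp add: K_def)
    show "ell2_nth ((1 / K) *\<^sub>R v m) k * ell2_nth ((1 / K) *\<^sub>R v n) k = 0" if "m \<noteq> n" for m n k
      using disj[OF that, of k] by auto
    show "c / (2 * K) \<le> \<beta> (r n) (z2_incl ((1 / K) *\<^sub>R v n))" for n
    proof -
      have "\<bar>\<beta> (r n) (z2_incl (z (r n) - v n))\<bar> \<le> C * norm (z (r n) - v n)"
        using sign_bounded_single[OF sb] by (metis z2_qnorm_incl)
      also have "\<dots> \<le> C * d" by (intro mult_left_mono v C)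
      finally have "\<beta> (r n) (z2_incl (z (r n))) - \<beta> (r n) (z2_incl (v n)) \<le> c/2"
        using Cd by (simp add: linear_diff[OF linear_z2_incl] linear_diff[OF lin])
      then have "c/2 \<le> \<beta> (r n) (z2_incl (v n))" using c(2)[of "r n"] by simp
      then have "c/2 / K \<le> \<beta> (r n) (z2_incl (v n)) / K" using K by (intro divide_right_mono) auto
      then show ?thesis by (simp add: linear_scale[OF linear_z2_incl] linear_scale[OF lin])
    qed
  qed (use lin C that in auto)
  \<comment> \<open>One more than the largest value that \<open>low\<close> allows for
    \<open>ln (sqrt N)\<close>; \<open>N \<ge> exp (2 * T)\<close> makes that logarithm reach
    \<open>T\<close>.\<close>
  define T where "T = 4 * C / (c / (2 * K)) + 1"
  define N where "N = nat \<lceil>exp (2 * T)\<rceil>"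
  have N: "exp (2 * T) \<le> N" unfolding N_def by linarith
  have N0: "0 < N" using less_le_trans[OF exp_gt_zero N] by simp
  have "T \<le> ln (sqrt N)"
    using ln_mono[OF N] N0 by (simp add: ln_sqrt)
  then have "c / (2 * K) * T \<le> 4 * C"
    using low[OF N0] c K by (smt (verit) mult_left_mono divide_pos_pos)
  moreover have "c / (2 * K) * T = 4 * C + c / (2 * K)"
    using c K by (simp add: T_def field_simps)
  moreover have "0 < c / (2 * K)" using c K by simp
  ultimately show False by simp
qed

section \<open>Sign-bounded sequences in \<open>z2\<close> are asymptotically in the kernel of the
  quotient map\<close>

text \<open>Otherwise the functionals \<open>z2_pairing (u (g n))\<close>, sign-bounded by
  continuity of the pairing, would be at least \<open>b\<^sup>2\<close> on the included quotient
  parts along a subsequence.\<close>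

lemma quot_tendsto_0:
  assumes su: "sign_bounded z2_qnorm D u" and D: "0 \<le> D"
  shows "(\<lambda>n. norm (z2_quot (u n))) \<longlonglongrightarrow> 0"
proof (rule ccontr)
  assume "\<not> ?thesis"
  then obtain b where b: "0 < b" and "\<not> (\<forall>\<^sub>F n in sequentially. norm (z2_quot (u n)) < b)"
    by (auto simp: tendsto_iff)
  then have "infinite {n. b \<le> norm (z2_quot (u n))}"
    by (simp add: not_eventually not_less frequently_cofinite flip: cofinite_eq_sequentially)
  then obtain g :: "nat \<Rightarrow> nat" where g: "strict_mono g" "\<And>n. b \<le> norm (z2_quot (u (g n)))"
    using infinite_enumerate by blast
  have sg: "sign_bounded z2_qnorm D (\<lambda>n. u (g n))"
    by (rule sign_bounded_subseq[OF su strict_mono_imp_inj_on[OF g(1)]])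
  show False
  proof (rule sign_bounded_incl_not_bounded_below)
    show "linear (z2_pairing (u (g n)))" for n by (rule linear_z2_pairing_right)
    show "sign_bounded abs ((2 * D) * z2_qnorm v) (\<lambda>n. z2_pairing (u (g n)) v)" for v
      using sign_bounded_image[OF sg linear_z2_pairing_left, of abs v "2 * z2_qnorm v"]
        z2_pairing_summable_bound(2)[of _ v] by (simp add: mult_ac)
    show "norm (z2_quot (u (g n))) \<le> D" for n
      using norm_quot_le_qnorm sign_bounded_single[OF sg] by (rule order_trans)
    \<comment> \<open>Coordinates of the quotient part are continuous linear functionals, so they
      inherit the 2-estimate and tend to 0.\<close>
    have "sign_bounded abs (1 * D) (\<lambda>n. ell2_nth (z2_quot (u (g n))) k)" for k
      using order_trans[OF abs_ell2_nth_le norm_quot_le_qnorm]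
      by (intro sign_bounded_image[OF sg]) (auto intro!: linearI)
    then show "(\<lambda>n. ell2_nth (z2_quot (u (g n))) k) \<longlonglongrightarrow> 0" for k
      by (rule sign_bounded_real_tendsto_0)
    show "b\<^sup>2 \<le> z2_pairing (u (g n)) (z2_incl (z2_quot (u (g n))))" for n
      using b g(2)[of n] by (simp add: z2_pairing_incl_quot)
  qed (use b D in auto)
qed

text \<open>As \<open>z2_dev\<close> is not linear, its coordinates are split: those of
  \<open>z2_fst\<close> are linear and inherit the 2-estimate, and those of \<open>KP\<close> are
  dominated by the norm of the quotient part.\<close>

lemma dev_nth_tendsto_0:
  assumes su: "sign_bounded z2_qnorm D u" and D: "0 \<le> D"
  shows "(\<lambda>n. ell2_nth (z2_dev (u n)) k) \<longlonglongrightarrow> 0"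
proof -
  have "sign_bounded abs (1 * D) (\<lambda>n. z2_fst (u n) k)"
    by (intro sign_bounded_image[OF su]) (auto intro!: linearI simp: abs_fst_le_qnorm)
  then have "(\<lambda>n. z2_fst (u n) k) \<longlonglongrightarrow> 0"
    by (rule sign_bounded_real_tendsto_0)
  moreover have "(\<lambda>n. KP (ell2_nth (z2_quot (u n))) k) \<longlonglongrightarrow> 0"
    by (rule Lim_null_comparison[OF _ quot_tendsto_0[OF su D]]) (simp add: abs_KP_le)
  ultimately show ?thesis
    unfolding z2_dev_nth using tendsto_diff by fastforce
qed

text \<open>In \<open>z2_decompose\<close> the section part of \<open>u n\<close> contributes to
  \<open>\<beta> n (u n)\<close> at most a multiple of the vanishing quotient norm. So the included
  deviations, bounded and coordinatewise null, eventually carry at least \<open>1/2\<close>.\<close>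

lemma no_biorthogonal_sign_bounded:
  fixes \<beta> :: "nat \<Rightarrow> z2 \<Rightarrow> real"
  assumes lin: "\<And>n. linear (\<beta> n)"
    and sb: "\<And>v. sign_bounded abs (C * z2_qnorm v) (\<lambda>n. \<beta> n v)" and C: "0 \<le> C"
    and su: "sign_bounded z2_qnorm D u" and D: "0 \<le> D"
    and one: "\<And>n. \<beta> n (u n) = 1"
  shows False
proof -
  have "(\<lambda>n. C * norm (z2_quot (u n))) \<longlonglongrightarrow> C * 0"
    by (intro tendsto_mult_left quot_tendsto_0[OF su D])
  then have "\<forall>\<^sub>F n in sequentially. C * norm (z2_quot (u n)) < 1/2"
    by (rule order_tendstoD) simp
  then obtain m where m: "\<And>n. m \<le> n \<Longrightarrow> C * norm (z2_quot (u n)) < 1/2"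
    by (auto simp: eventually_sequentially)
  show False
  proof (rule sign_bounded_incl_not_bounded_below[where \<beta> = "\<lambda>n. \<beta> (n + m)"])
    show "sign_bounded abs (C * z2_qnorm v) (\<lambda>n. \<beta> (n + m) v)" for v
      by (rule sign_bounded_subseq[OF sb]) (simp add: inj_def)
    show "norm (z2_dev (u (n + m))) \<le> D" for n
      using sign_bounded_single[OF su, of "n + m"] norm_ge_zero[of "z2_quot (u (n + m))"]
      unfolding z2_qnorm_eq by linarith
    show "(\<lambda>n. ell2_nth (z2_dev (u (n + m))) k) \<longlonglongrightarrow> 0" for k
      by (rule LIMSEQ_ignore_initial_segment[OF dev_nth_tendsto_0[OF su D]])
    show "1/2 \<le> \<beta> (n + m) (z2_incl (z2_dev (u (n + m))))" for n
    proof -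
      let ?u = "u (n + m)"
      have "\<bar>\<beta> (n + m) (z2_sec (z2_quot ?u))\<bar> \<le> C * norm (z2_quot ?u)"
        using sign_bounded_single[OF sb] by (metis z2_qnorm_sec)
      also have "\<dots> < 1/2" by (rule m) simp
      finally show ?thesis
        using one[of "n + m"] linear_add[OF lin, of "n + m" "z2_incl (z2_dev ?u)" "z2_sec (z2_quot ?u)"]
        by (simp flip: z2_decompose)
    qed
  qed (use lin C in auto)
qed

section \<open>Bounds from continuity\<close>

text \<open>The gauge \<open>p\<close>, controlled on a neighbourhood of 0, lets the target be
  either a normed space or \<open>z2\<close> with its quasinorm.\<close>

lemma continuous_linear_bounded:
  fixes f :: "'a::real_normed_vector \<Rightarrow> 'b::{real_vector, topological_space}"
  assumes "linear f" "continuous_on UNIV f" "open U" "0 \<in> U"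
    and p: "\<And>u. u \<in> U \<Longrightarrow> p u < 1" "\<And>c u. p (c *\<^sub>R u) = \<bar>c\<bar> * p u"
  obtains C where "0 \<le> C" "\<And>x. p (f x) \<le> C * norm x"
proof -
  have "open (f -` U)" by (rule open_vimage[OF assms(3,2)])
  moreover have "0 \<in> f -` U" using assms(4) by (simp add: linear_0[OF assms(1)])
  ultimately obtain e where e: "0 < e" "\<And>x. norm x < e \<Longrightarrow> f x \<in> U"
    unfolding open_dist by (force simp: dist_norm)
  have "p (f x) \<le> 2 / e * norm x" for x
  proof (cases "x = 0")
    case True
    then show ?thesis using p(2)[of 0 0] by (simp add: linear_0[OF assms(1)])
  next
    case False
    define t where "t = e / (2 * norm x)"
    have t: "0 < t" using False e by (simp add: t_def)
    have "norm (t *\<^sub>R x) < e" using False e by (simp add: t_def)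
    then have "p (f (t *\<^sub>R x)) < 1" by (intro p(1) e(2))
    then have "t * p (f x) < 1"
      using p(2) t by (simp add: linear_scale[OF assms(1)])
    then have "p (f x) < 1 / t" using t by (simp add: field_simps)
    then show ?thesis using False by (simp add: t_def)
  qed
  then show thesis using e(1) by (intro that[of "2 / e"]) auto
qed

text \<open>Closedness gives a ball around \<open>u0\<close> that misses the kernel; the kernel
  vector \<open>u0 - (1 / f u) *\<^sub>R u\<close> must lie outside it.\<close>

lemma hyperplane_functional_bounded:
  fixes f :: "z2 \<Rightarrow> real"
  assumes "linear f" "closed {u. f u = 0}" "f u0 = 1"
  obtains C where "0 \<le> C" "\<And>u. \<bar>f u\<bar> \<le> C * z2_qnorm u"
proof -
  have "open (- {u. f u = 0})" using assms(2) by (rule open_Compl)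
  moreover have "u0 \<in> - {u. f u = 0}" using assms(3) by simp
  ultimately have "\<exists>e>0. \<forall>v. z2_qnorm (v - u0) < e \<longrightarrow> v \<in> - {u. f u = 0}"
    unfolding open_z2_def by (rule bspec)
  then obtain e where e: "0 < e" "\<And>v. z2_qnorm (v - u0) < e \<Longrightarrow> f v \<noteq> 0" by auto
  have "\<bar>f u\<bar> \<le> (1 / e) * z2_qnorm u" for u
  proof (cases "f u = 0")
    case False
    let ?v = "u0 - (1 / f u) *\<^sub>R u"
    have "f ?v = 0"
      using False assms(3) by (simp add: linear_diff[OF assms(1)] linear_scale[OF assms(1)])
    then have "e \<le> z2_qnorm (?v - u0)" using e(2)[of ?v] by linarith
    also have "\<dots> = z2_qnorm u / \<bar>f u\<bar>"
      using z2_qnorm_scaleR[of "- (1 / f u)" u] by simp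
    finally show ?thesis using False e(1) by (simp add: field_simps)
  qed (use e in simp)
  then show thesis using e(1) by (intro that[of "1 / e"]) auto
qed

text \<open>Continuity at the origin bounds the form by 1 on small vectors of \<open>H\<close>.
  Scaling each argument to half the admissible radius gives the constant
  \<open>4 / (d * e)\<close>.\<close>

lemma bilinear_on_bounded:
  assumes H: "hyperplane H" and bil: "bilinear_on H \<Omega>"
    and cont: "continuous_on (H \<times> H) (\<lambda>(u, v). \<Omega> u v)"
  obtains C where "0 \<le> C" "\<And>u v. u \<in> H \<Longrightarrow> v \<in> H \<Longrightarrow> \<bar>\<Omega> u v\<bar> \<le> C * z2_qnorm u * z2_qnorm v"
proof -
  obtain f :: "z2 \<Rightarrow> real" where f: "linear f" "H = {u. f u = 0}"
    using H by (auto simp: hyperplane_def)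
  have H0: "0 \<in> H" and Hs: "\<And>u c. u \<in> H \<Longrightarrow> c *\<^sub>R u \<in> H"
    by (auto simp: f linear_0 linear_scale)
  have sc: "\<Omega> (s *\<^sub>R u) (t *\<^sub>R v) = s * t * \<Omega> u v" if "u \<in> H" "v \<in> H" for s t u v
    using bil that Hs by (simp add: bilinear_on_def)
  have z: "\<Omega> 0 v = 0" "\<Omega> v 0 = 0" if "v \<in> H" for v
    using sc[OF H0 that, of 0 1] sc[OF that H0, of 1 0] by simp_all
  obtain A where A: "open A" "A \<inter> (H \<times> H) = (\<lambda>(u, v). \<Omega> u v) -` {-1<..<1} \<inter> (H \<times> H)"
    using cont unfolding continuous_on_open_invariant by (meson open_greaterThanLessThan)
  have "(0, 0) \<in> A" using A(2) z(1)[OF H0] H0 by auto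
  then obtain S T where ST: "open S" "open T" "0 \<in> S" "0 \<in> T" "S \<times> T \<subseteq> A"
    using open_prod_elim[OF A(1)] by (metis mem_Sigma_iff)
  obtain d where d: "0 < d" "\<And>u. z2_qnorm u < d \<Longrightarrow> u \<in> S"
    using ST(1,3) unfolding open_z2_def by force
  obtain e where e: "0 < e" "\<And>u. z2_qnorm u < e \<Longrightarrow> u \<in> T"
    using ST(2,4) unfolding open_z2_def by force
  have small: "\<bar>\<Omega> u v\<bar> < 1" if "u \<in> H" "v \<in> H" "z2_qnorm u < d" "z2_qnorm v < e" for u v
  proof -
    have "(u, v) \<in> A \<inter> (H \<times> H)" using that d e ST(5) by auto
    then show ?thesis unfolding A(2) by auto
  qed
  have "\<bar>\<Omega> u v\<bar> \<le> 4 / (d * e) * z2_qnorm u * z2_qnorm v" if uv: "u \<in> H" "v \<in> H" for u v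
  proof (cases "u = 0 \<or> v = 0")
    case True
    then show ?thesis using z uv by auto
  next
    case False
    then have q: "0 < z2_qnorm u" "0 < z2_qnorm v"
      using z2_qnorm_eq_0[of u] z2_qnorm_eq_0[of v] z2_qnorm_nonneg[of u] z2_qnorm_nonneg[of v]
      by linarith+
    define s where "s = d / (2 * z2_qnorm u)"
    define t where "t = e / (2 * z2_qnorm v)"
    have st: "0 < s" "0 < t" using q d(1) e(1) by (auto simp: s_def t_def)
    have "\<bar>\<Omega> (s *\<^sub>R u) (t *\<^sub>R v)\<bar> < 1"
      using q d(1) e(1) st uv by (intro small Hs) (auto simp: z2_qnorm_scaleR s_def t_def)
    then have "s * t * \<bar>\<Omega> u v\<bar> < 1" using st by (simp add: sc[OF uv] abs_mult)
    then have "\<bar>\<Omega> u v\<bar> < 1 / (s * t)" using st by (simp add: field_simps)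
    also have "\<dots> = 4 / (d * e) * z2_qnorm u * z2_qnorm v"
      by (simp add: s_def t_def)
    finally show ?thesis by simp
  qed
  then show thesis using d(1) e(1) by (intro that[of "4 / (d * e)"]) auto
qed

section \<open>Coordinate functionals and the inverse of a symplectic form\<close>

definition ell2_coord :: "nat \<Rightarrow> ell2 \<Rightarrow>\<^sub>L real" where
  "ell2_coord n = Blinfun (\<lambda>x. ell2_nth x n)"

lemma ell2_coord_apply [simp]: "blinfun_apply (ell2_coord n) x = ell2_nth x n"
proof -
  have "bounded_linear (\<lambda>x. ell2_nth x n)"
    by (rule bounded_linear_intro[of _ 1]) (auto simp: abs_ell2_nth_le)
  then show ?thesis by (simp add: ell2_coord_def bounded_linear_Blinfun_apply)
qed

lemma sign_bounded_ell2_unit: "sign_bounded norm 1 ell2_unit"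
  unfolding sign_bounded_def
  by (auto intro!: norm_sum_disjoint simp: ell2_unit.rep_eq)

text \<open>Cauchy-Schwarz against the vector of signs, whose norm on \<open>F\<close> is
  \<open>sqrt (card F)\<close>.\<close>

lemma sign_bounded_ell2_coord: "sign_bounded norm 1 ell2_coord"
  unfolding sign_bounded_def
proof (intro allI impI)
  fix F :: "nat set" and e :: "nat \<Rightarrow> real"
  assume F: "finite F" "\<forall>n. \<bar>e n\<bar> = 1"
  have "norm (\<Sum>n\<in>F. e n *\<^sub>R ell2_coord n) \<le> sqrt (card F)"
  proof (rule norm_blinfun_bound)
    fix x
    have "norm (blinfun_apply (\<Sum>n\<in>F. e n *\<^sub>R ell2_coord n) x) = \<bar>\<Sum>n\<in>F. e n * ell2_nth x n\<bar>"
      by (simp add: blinfun.sum_left blinfun.scaleR_left)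
    also have "\<dots> \<le> (\<Sum>n\<in>F. \<bar>e n\<bar> * \<bar>ell2_nth x n\<bar>)"
      by (rule order_trans[OF sum_abs]) (simp add: abs_mult)
    also have "\<dots> \<le> L2_set e F * L2_set (ell2_nth x) F" by (rule L2_set_mult_ineq)
    also have "\<dots> \<le> sqrt (card F) * norm x"
    proof (intro mult_mono L2_set_le_norm_ell2 F)
      have "(e n)\<^sup>2 = 1" for n using F(2) by (metis power2_abs one_power2)
      then show "L2_set e F \<le> sqrt (card F)" by (simp add: L2_set_def)
    qed auto
    finally show "norm (blinfun_apply (\<Sum>n\<in>F. e n *\<^sub>R ell2_coord n) x) \<le> sqrt (card F) * norm x" .
  qed simp
  then show "norm (\<Sum>n\<in>F. e n *\<^sub>R ell2_coord n) \<le> 1 * sqrt (card F)" by simp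
qed

text \<open>\<open>g\<close> is the inverse of the isomorphism onto the dual, bounded because it is
  continuous. It represents any functional, in particular a coordinate, through the form.\<close>

lemma symplectic_form_inverse:
  fixes \<omega> :: "'a::banach \<Rightarrow> 'a \<Rightarrow> real"
  assumes "symplectic_form \<omega>"
  obtains g :: "('a \<Rightarrow>\<^sub>L real) \<Rightarrow> 'a" and C where "linear g" "0 \<le> C" "\<And>\<psi>. norm (g \<psi>) \<le> C * norm \<psi>"
    "\<And>\<psi> y. \<omega> (g \<psi>) y = blinfun_apply \<psi> y"
proof -
  define L where "L x = Blinfun (\<omega> x)" for x
  have bb: "bounded_bilinear \<omega>" and L: "isomorphism_into L" "surj L"
    using assms by (auto simp: symplectic_form_def Let_def L_def[abs_def])
  have Lapp: "blinfun_apply (L x) = \<omega> x" for x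
    by (simp add: L_def bounded_linear_Blinfun_apply[OF bounded_bilinear.bounded_linear_right[OF bb]])
  obtain g where lin: "linear L" and g: "homeomorphism UNIV UNIV L g"
    using L by (auto simp: isomorphism_into_def)
  have Lg: "L (g \<psi>) = \<psi>" and gL: "g (L x) = x" for \<psi> x
    using g by (auto simp: homeomorphism_def)
  have lg: "linear g"
  proof (rule linearI)
    show "g (a + b) = g a + g b" for a b
      using gL[of "g a + g b"] by (simp add: linear_add[OF lin] Lg)
    show "g (c *\<^sub>R a) = c *\<^sub>R g a" for c a
      using gL[of "c *\<^sub>R g a"] by (simp add: linear_scale[OF lin] Lg)
  qed
  moreover obtain C where "0 \<le> C" "\<And>\<psi>. norm (g \<psi>) \<le> C * norm \<psi>"
  proof (rule continuous_linear_bounded[OF lg, of "ball 0 1" norm])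
    show "continuous_on UNIV g" using g by (simp add: homeomorphism_def)
  qed auto
  moreover have "\<omega> (g \<psi>) y = blinfun_apply \<psi> y" for \<psi> y
    by (simp add: Lg flip: Lapp)
  ultimately show thesis using that by blast
qed

section \<open>From an extended form to the forbidden pair of sequences\<close>

theorem corollary8p5:
  fixes H :: "z2 set" and j :: "ell2 \<Rightarrow> z2" and \<omega> :: "ell2 \<Rightarrow> ell2 \<Rightarrow> real"
  assumes "hyperplane H" and "closed H"
    and "isomorphism_into j" and "range j \<subseteq> H"
    and "symplectic_form \<omega>"
  shows "\<not> (\<exists>\<Omega> :: z2 \<Rightarrow> z2 \<Rightarrow> real.
             bilinear_on H \<Omega> \<and> continuous_on (H \<times> H) (\<lambda>(u, v). \<Omega> u v) \<and>
             (\<forall>x y. \<Omega> (j x) (j y) = \<omega> x y))"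
proof (rule notI, elim exE conjE)
  fix \<Omega> :: "z2 \<Rightarrow> z2 \<Rightarrow> real"
  assume bil: "bilinear_on H \<Omega>" and cont: "continuous_on (H \<times> H) (\<lambda>(u, v). \<Omega> u v)"
    and ext: "\<forall>x y. \<Omega> (j x) (j y) = \<omega> x y"
  obtain f :: "z2 \<Rightarrow> real" and u1 where f: "linear f" "f u1 \<noteq> 0" and H: "H = {u. f u = 0}"
    using assms(1) by (auto simp: hyperplane_def)
  define u0 where "u0 = (1 / f u1) *\<^sub>R u1"
  have fu0: "f u0 = 1" using f by (simp add: u0_def linear_scale)
  obtain Cf where Cf: "0 \<le> Cf" "\<And>u. \<bar>f u\<bar> \<le> Cf * z2_qnorm u"
    using hyperplane_functional_bounded[OF f(1) _ fu0] assms(2) H by metis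
  \<comment> \<open>The projection onto \<open>H\<close> along \<open>u0\<close>, which carries
    functionals from \<open>H\<close> to all of \<open>z2\<close>.\<close>
  define P where "P v = v - f v *\<^sub>R u0" for v
  have PH: "P v \<in> H" for v
    by (simp add: P_def H linear_diff[OF f(1)] linear_scale[OF f(1)] fu0)
  have linP: "linear P"
    by (rule linearI) (simp_all add: P_def linear_add[OF f(1)] linear_scale[OF f(1)] algebra_simps)
  define Cp where "Cp = 5 * (1 + Cf * z2_qnorm u0)"
  have Cp: "0 \<le> Cp" using Cf(1) by (simp add: Cp_def)
  have qP: "z2_qnorm (P v) \<le> Cp * z2_qnorm v" for v
  proof -
    have "z2_qnorm (P v) \<le> 5 * (z2_qnorm v + \<bar>f v\<bar> * z2_qnorm u0)"
      using z2_qnorm_add_le[of v "(- f v) *\<^sub>R u0"] unfolding z2_qnorm_scaleR by (simp add: P_def)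
    also have "\<dots> \<le> 5 * (z2_qnorm v + Cf * z2_qnorm v * z2_qnorm u0)"
      by (intro mult_left_mono add_left_mono mult_right_mono Cf) auto
    finally show ?thesis by (simp add: Cp_def algebra_simps)
  qed
  obtain CO where CO: "0 \<le> CO" "\<And>u v. u \<in> H \<Longrightarrow> v \<in> H \<Longrightarrow> \<bar>\<Omega> u v\<bar> \<le> CO * z2_qnorm u * z2_qnorm v"
    by (rule bilinear_on_bounded[OF assms(1) bil cont]) (rule that; blast)
  have linj: "linear j" and contj: "continuous_on UNIV j"
    using assms(3) by (auto simp: isomorphism_into_def homeomorphism_def)
  have jH: "j x \<in> H" for x using assms(4) by auto
  obtain U where U: "open U" "0 \<in> U" "\<And>u. u \<in> U \<Longrightarrow> z2_qnorm u < 1"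
    by (rule z2_qnorm_ball_nhd) blast
  obtain Cj where Cj: "0 \<le> Cj" "\<And>x. z2_qnorm (j x) \<le> Cj * norm x"
    using continuous_linear_bounded[where p = z2_qnorm, OF linj contj U(1,2)] U(3) z2_qnorm_scaleR
    by blast
  obtain g Cg where g: "linear g" "0 \<le> Cg" "\<And>\<psi>. norm (g \<psi>) \<le> Cg * norm \<psi>"
    and \<omega>g: "\<And>\<psi> y. \<omega> (g \<psi>) y = blinfun_apply \<psi> y"
    by (rule symplectic_form_inverse[OF assms(5)]) (rule that; blast)
  \<comment> \<open>Only the second argument is projected; the first already lies in
    \<open>H\<close>.\<close>
  define B where "B \<psi> v = \<Omega> (j (g \<psi>)) (P v)" for \<psi> v
  have add: "\<Omega> (a + b) c = \<Omega> a c + \<Omega> b c" "\<Omega> c (a + b) = \<Omega> c a + \<Omega> c b"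
    if "a \<in> H" "b \<in> H" "c \<in> H" for a b c using bil that by (auto simp: bilinear_on_def)
  have scale: "\<Omega> (r *\<^sub>R a) c = r * \<Omega> a c" "\<Omega> c (r *\<^sub>R a) = r * \<Omega> c a"
    if "a \<in> H" "c \<in> H" for a c r using bil that by (auto simp: bilinear_on_def)
  have lin1: "linear (\<lambda>\<psi>. B \<psi> v)" for v
    by (rule linearI) (simp_all add: B_def linear_add[OF g(1)] linear_add[OF linj]
        linear_scale[OF g(1)] linear_scale[OF linj] add scale jH PH)
  have lin2: "linear (B \<psi>)" for \<psi>
    by (rule linearI) (simp_all add: B_def linear_add[OF linP] linear_scale[OF linP] add scale jH PH)
  define C where "C = CO * Cj * Cg * Cp"
  have C: "0 \<le> C" using CO Cj g Cp by (simp add: C_def)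
  have bound: "\<bar>B \<psi> v\<bar> \<le> (C * z2_qnorm v) * norm \<psi>" for \<psi> v
  proof -
    have "\<bar>B \<psi> v\<bar> \<le> CO * z2_qnorm (j (g \<psi>)) * z2_qnorm (P v)"
      unfolding B_def by (intro CO jH PH)
    also have "\<dots> \<le> CO * (Cj * (Cg * norm \<psi>)) * (Cp * z2_qnorm v)"
      using CO(1) Cj(1) g(2)
      by (intro mult_mono mult_left_mono qP order_trans[OF Cj(2)] g(3)) auto
    finally show ?thesis by (simp add: C_def mult_ac)
  qed
  show False
  proof (rule no_biorthogonal_sign_bounded)
    show "linear (B (ell2_coord n))" for n by (rule lin2)
    show "sign_bounded abs (C * z2_qnorm v) (\<lambda>n. B (ell2_coord n) v)" for v
      using sign_bounded_image[OF sign_bounded_ell2_coord lin1 bound] C by simp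
    show "sign_bounded z2_qnorm Cj (\<lambda>n. j (ell2_unit n))"
      using sign_bounded_image[OF sign_bounded_ell2_unit linj Cj(2,1)] by simp
    \<comment> \<open>\<open>P\<close> fixes the range of \<open>j\<close>, so on it
      \<open>B\<close> reduces to \<open>\<omega> (g \<psi>)\<close>, that is, to
      \<open>\<psi>\<close> itself.\<close>
    have "P (j x) = j x" for x using jH[of x] by (simp add: P_def H)
    then show "B (ell2_coord n) (j (ell2_unit n)) = 1" for n
      by (simp add: B_def ext \<omega>g ell2_unit.rep_eq)
  qed (rule C Cj(1))+
qed

end
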